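(* Let $\mathcal{L}=\operatorname{Lip}_1(\mathbb{R})$. If a sequence $\{\mathcal{P}_n\}_{n=1}^\infty$ of $\operatorname{Lip}_1(\mathbb{R})$-pyramids converges weakly to $\mathcal{P}\subset\mathcal{D}/\operatorname{Lip}_1(\mathbb{R})$, then for any $\kappa\in(0,1)$, $$\operatorname{ObsDiam}(\mathcal{P};-\kappa)=\lim_{\epsilon\to+0}\liminf_{n\to\infty}\operatorname{ObsDiam}(\mathcal{P}_n;-(\kappa+\epsilon))=\lim_{\epsilon\to+0}\limsup_{n\to\infty}\operatorname{ObsDiam}(\mathcal{P}_n;-(\kappa+\epsilon)).$$
   Context: Geometric data sets: a geometric data set is a triple $X=(X,F_X,\mu_X)$ where $F_X$ is a nonempty set of real-valued functions on $X$ such that $d_X(x,y):=\sup_{f\in F_X}|f(x)-f(y)|$ is a complete separable metric on $X$, and $\mu_X$ is a Borel probability measure with full support on $(X,d_X)$. $\overline{F_X}$ denotes the closure of $F_X$ under pointwise convergence. $X$ and $Y$ are isomorphic if there is a bijection $\varphi:X\to Y$ with $\varphi_*\mu_X=\mu_Y$ and $\overline{F_Y}\circ\varphi=\overline{F_X}$; $\mathcal{D}$ is the set of isomorphism classes. Domination: $Y\preceq X$ if there is a Borel measurable map $f:X\to Y$ with $f_*\mu_X=\mu_Y$ and $F_Y\circ f\subset\overline{F_X}$. Ky Fan metric: $d_{\mathrm{KF}}^X(f,g):=\inf\{\epsilon\ge 0: \mu_X(\{|f-g|>\epsilon\})\le\epsilon\}$. For a metric $d$, $U(A,\epsilon;d)$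 is the open $\epsilon$-neighborhood of $A$ and $d_{\mathrm{H}}$ is the Hausdorff distance. Box distance: $\Pi(\mu_X,\mu_Y)$ is the set of couplings; $d_\infty^S(f,g):=\sup_{S}|f-g|$; $$\Box(X,Y)=\min_{\pi\in\Pi(\mu_X,\mu_Y),\ S}\max\{1-\pi(S),\,2(d_\infty^S)_{\mathrm{H}}(\overline{F_X}\circ\mathrm{pr}_1,\overline{F_Y}\circ\mathrm{pr}_2)\},$$ where $S$ runs over nonempty closed subsets of $X\times Y$. $\mathcal{L}$-compactness for $\mathcal{L}=\operatorname{Lip}_1(\mathbb{R})$ (the set of all 1-Lipschitz functions $\mathbb{R}\to\mathbb{R}$): $\mathcal{L}\circ F:=\{p\circ f: p\in\mathcal{L}, f\in F\}$; $\operatorname{Cov}(F,\epsilon;\mathcal{L}):=\inf\{\#\mathcal{N}: \mathcal{N}\subset F\text{ finite}, F\subset U(\mathcal{L}\circ\mathcal{N},\epsilon;d_{\mathrm{KF}}^X)\}$ for $F\subset\overline{F_X}$, $\epsilon>0$. $X$ is $\mathcal{L}$-compact if $\mathcal{L}\circ\overline{F_X}\subset\overline{F_X}$ and $\operatorname{Cov}(\overline{F_X},\epsilon;\mathcal{L})<\infty$ for every $\epsilon>0$. $\mathcal{D}/\mathcal{L}$ is the set of isomorphism classes of $\mathcal{L}$-compact geometric data sets. $\mathcal{L}$-pyramids: $\mathcal{P}\subset\mathcal{D}/\mathcal{L}$ is an $\mathcal{L}$-pyramid if (1) for $X\in\mathcal{D}/\mathcal{L}$ and $Y\in\mathcal{P}$,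 $X\preceq Y$ implies $X\in\mathcal{P}$; (2) for $X,Y\in\mathcal{P}$ there is $Z\in\mathcal{P}$ with $X\preceq Z$, $Y\preceq Z$; (3) $\mathcal{P}$ is nonempty and $\Box$-closed. Weak convergence: closed sets $\mathcal{P}_n$ converge weakly (in the weak Hausdorff sense) to a closed set $\mathcal{P}$ in $(\mathcal{D}/\mathcal{L},\Box)$ if $\lim_n\Box(X,\mathcal{P}_n)=0$ for all $X\in\mathcal{P}$ and $\liminf_n\Box(X,\mathcal{P}_n)>0$ for all $X\in(\mathcal{D}/\mathcal{L})\setminus\mathcal{P}$, where $\Box(X,A):=\inf_{Y\in A}\Box(X,Y)$. Observable diameter: for a Borel probability measure $\mu$ on $\mathbb{R}$ and $\kappa\in(0,1)$, $\operatorname{PartDiam}(\mu;1-\kappa):=\inf\{\operatorname{diam} I: I\subset\mathbb{R}\text{ Borel}, \mu(I)\ge 1-\kappa\}$. For a geometric data set $X$, $\operatorname{ObsDiam}(X;-\kappa):=\sup_{f\in F_X}\operatorname{PartDiam}(f_*\mu_X;1-\kappa)$. For $\mathcal{E}\subset\mathcal{D}$, $\operatorname{ObsDiam}(\mathcal{E};-\kappa):=\sup_{X\in\mathcal{E}}\operatorname{ObsDiam}(X;-\kappa)\in[0,+\infty]$. *)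

theory Defs
  imports "HOL-Probability.Probability"
begin

text \<open>Functions on the point set are normalised to be extensional (the constant
  \<^const>\<open>undefined\<close> off the point set), so that equality of functions in HOL is equality of
  functions on the point set.\<close>

record 'a data_set =
  pts :: "'a set"
  feats :: "('a \<Rightarrow> real) set"
  law :: "'a measure"

text \<open>The value \<open>0\<close> off the point set is only there because \<^locale>\<open>Metric_space\<close>
  asks for nonnegativity and symmetry on the whole type.\<close>

definition feat_dist :: "'a data_set \<Rightarrow> 'a \<Rightarrow> 'a \<Rightarrow> real" where
  "feat_dist X x y =
     (if x \<in> pts X \<and> y \<in> pts X then (SUP f\<in>feats X. \<bar>f x - f y\<bar>) else 0)"

definition feat_topology :: "'a data_set \<Rightarrow> 'a topology" where
  "feat_topology X = Metric_space.mtopology (pts X) (feat_dist X)"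

definition geometric_data_set :: "'a data_set \<Rightarrow> bool" where
  "geometric_data_set X \<longleftrightarrow>
     feats X \<noteq> {} \<and> feats X \<subseteq> extensional (pts X) \<and>
     (\<forall>x\<in>pts X. \<forall>y\<in>pts X. bdd_above ((\<lambda>f. \<bar>f x - f y\<bar>) ` feats X)) \<and>
     Metric_space (pts X) (feat_dist X) \<and>
     Metric_space.mcomplete (pts X) (feat_dist X) \<and>
     separable_space (feat_topology X) \<and>
     space (law X) = pts X \<and>
     sets (law X) = sigma_sets (pts X) {U. openin (feat_topology X) U} \<and>
     prob_space (law X) \<and>
     (\<forall>U. openin (feat_topology X) U \<and> U \<noteq> {} \<longrightarrow> emeasure (law X) U > 0)"

text \<open>The closure of the feature set under pointwise convergence; the points of the product
  topology are exactly the extensional functions.\<close>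

definition feat_closure :: "'a data_set \<Rightarrow> ('a \<Rightarrow> real) set" where
  "feat_closure X = product_topology (\<lambda>_. euclideanreal) (pts X) closure_of feats X"

definition isomorphic :: "'a data_set \<Rightarrow> 'b data_set \<Rightarrow> bool" where
  "isomorphic X Y \<longleftrightarrow>
     (\<exists>\<phi>. bij_betw \<phi> (pts X) (pts Y) \<and>
          \<phi> \<in> law X \<rightarrow>\<^sub>M law Y \<and> distr (law X) (law Y) \<phi> = law Y \<and>
          (\<lambda>g. compose (pts X) g \<phi>) ` feat_closure Y = feat_closure X)"

definition dominated_by :: "'b data_set \<Rightarrow> 'a data_set \<Rightarrow> bool"  (infix \<open>\<preceq>\<^sub>D\<close> 50) where
  "Y \<preceq>\<^sub>D X \<longleftrightarrow>
     (\<exists>\<phi> \<in> law X \<rightarrow>\<^sub>M law Y. distr (law X) (law Y) \<phi> = law Y \<and>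
          (\<lambda>g. compose (pts X) g \<phi>) ` feats Y \<subseteq> feat_closure X)"

definition nbhd :: "'c set \<Rightarrow> 'd \<Rightarrow> ('c \<Rightarrow> 'c \<Rightarrow> 'd::linorder) \<Rightarrow> 'c set" where
  "nbhd A \<epsilon> d = {x. \<exists>a\<in>A. d x a < \<epsilon>}"

definition hausdorff_dist :: "('c \<Rightarrow> 'c \<Rightarrow> ennreal) \<Rightarrow> 'c set \<Rightarrow> 'c set \<Rightarrow> ennreal" where
  "hausdorff_dist d A B = Inf {\<epsilon>. \<epsilon> > 0 \<and> A \<subseteq> nbhd B \<epsilon> d \<and> B \<subseteq> nbhd A \<epsilon> d}"

definition ky_fan :: "'a data_set \<Rightarrow> ('a \<Rightarrow> real) \<Rightarrow> ('a \<Rightarrow> real) \<Rightarrow> real" where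
  "ky_fan X f g =
     Inf {\<epsilon>. \<epsilon> \<ge> 0 \<and> measure (law X) {x\<in>pts X. \<bar>f x - g x\<bar> > \<epsilon>} \<le> \<epsilon>}"

definition unif_dist :: "'c set \<Rightarrow> ('c \<Rightarrow> real) \<Rightarrow> ('c \<Rightarrow> real) \<Rightarrow> ennreal" where
  "unif_dist S f g = (SUP s\<in>S. ennreal \<bar>f s - g s\<bar>)"

text \<open>By separability the product \<open>\<sigma>\<close>-algebra is the Borel \<open>\<sigma>\<close>-algebra of the product
  topology.\<close>

definition couplings :: "'a data_set \<Rightarrow> 'b data_set \<Rightarrow> ('a \<times> 'b) measure set" where
  "couplings X Y =
     {\<pi>. sets \<pi> = sets (law X \<Otimes>\<^sub>M law Y) \<and>
         distr \<pi> (law X) fst = law X \<and> distr \<pi> (law Y) snd = law Y}"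

text \<open>The box distance is the value of a minimum that is attained; it is written here as an
  infimum.  It lies in \<open>[0,\<infinity>]\<close> because the Hausdorff distance may be infinite.\<close>

definition box_dist :: "'a data_set \<Rightarrow> 'b data_set \<Rightarrow> ennreal" where
  "box_dist X Y =
     (INF (\<pi>, S) \<in> couplings X Y \<times>
          {S. closedin (prod_topology (feat_topology X) (feat_topology Y)) S \<and> S \<noteq> {}}.
        max (ennreal (1 - measure \<pi> S))
            (2 * hausdorff_dist (unif_dist S)
                   ((\<lambda>f. f \<circ> fst) ` feat_closure X) ((\<lambda>g. g \<circ> snd) ` feat_closure Y)))"

definition box_dist_set :: "'a data_set \<Rightarrow> 'b data_set set \<Rightarrow> ennreal" where
  "box_dist_set X \<A> = (INF Y\<in>\<A>. box_dist X Y)"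

definition Lip1 :: "(real \<Rightarrow> real) set" where
  "Lip1 = {p. 1-lipschitz_on UNIV p}"

definition comp_feats ::
    "(real \<Rightarrow> real) set \<Rightarrow> 'a data_set \<Rightarrow> ('a \<Rightarrow> real) set \<Rightarrow> ('a \<Rightarrow> real) set" where
  "comp_feats \<L> X F = (\<lambda>(p, f). compose (pts X) p f) ` (\<L> \<times> F)"

definition Cov ::
    "'a data_set \<Rightarrow> ('a \<Rightarrow> real) set \<Rightarrow> real \<Rightarrow> (real \<Rightarrow> real) set \<Rightarrow> enat" where
  "Cov X F \<epsilon> \<L> =
     (INF N \<in> {N. finite N \<and> N \<subseteq> F \<and> F \<subseteq> nbhd (comp_feats \<L> X N) \<epsilon> (ky_fan X)}.
        enat (card N))"

definition L_compact :: "(real \<Rightarrow> real) set \<Rightarrow> 'a data_set \<Rightarrow> bool" where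
  "L_compact \<L> X \<longleftrightarrow>
     comp_feats \<L> X (feat_closure X) \<subseteq> feat_closure X \<and>
     (\<forall>\<epsilon>>0. Cov X (feat_closure X) \<epsilon> \<L> < \<infinity>)"

lemma ex_inj_on_separable_metric:
  assumes "Metric_space M d" and sep: "separable_space (Metric_space.mtopology M d)"
  shows "\<exists>\<psi> :: 'a \<Rightarrow> real. inj_on \<psi> M"
proof -
  interpret Metric_space M d by fact
  obtain C where C: "countable C" "C \<subseteq> M" "mtopology closure_of C = M"
    using sep unfolding separable_space_def by auto
  define e where "e x = {prod_encode (to_nat_on C c, k) | c k.
                          c \<in> C \<and> d c x < 1 / real (Suc k)}" for x
  have dense: "\<exists>c\<in>C. d c x < r" if "x \<in> M" "r > 0" for x r
  proof -
    have "openin mtopology (mball x r)" "mball x r \<noteq> {}"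
      using that by auto
    then have "C \<inter> mball x r \<noteq> {}"
      using C dense_intersects_open[of mtopology C] by auto
    then show ?thesis by (auto simp: commute)
  qed
  have "inj_on e M"
  proof (rule inj_onI, rule ccontr)
    fix x y assume xy: "x \<in> M" "y \<in> M" "e x = e y" "x \<noteq> y"
    then have "d x y / 2 > 0" by simp
    then obtain k where k: "1 / real (Suc k) < d x y / 2"
      using nat_approx_posE by (metis inverse_eq_divide)
    obtain c where c: "c \<in> C" "d c x < 1 / real (Suc k)"
      using dense[OF xy(1), of "1 / real (Suc k)"] by auto
    then have "prod_encode (to_nat_on C c, k) \<in> e y"
      using xy(3) unfolding e_def by blast
    then obtain c' where c': "c' \<in> C" "to_nat_on C c = to_nat_on C c'" "d c' y < 1 / real (Suc k)"
      unfolding e_def by auto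
    then have "c' = c" using c C(1) by (metis inj_onD inj_on_to_nat_on)
    then have "d x y < 2 * (1 / real (Suc k))"
      using triangle[of x c y] c c' xy C(2) by (auto simp: commute)
    with k show False by linarith
  qed
  moreover obtain h :: "nat set \<Rightarrow> real" where "inj h"
    using eqpoll_imp_lepoll[OF nat_sets_eqpoll_reals] unfolding lepoll_def by auto
  ultimately have "inj_on (h \<circ> e) M"
    by (auto intro: comp_inj_on inj_on_subset)
  then show ?thesis by blast
qed

lemma ex_isomorphic_real_data_set:
  fixes X :: "'a data_set"
  assumes "geometric_data_set X"
  shows "\<exists>Y :: real data_set. geometric_data_set Y \<and> isomorphic X Y"
proof -
  define M where "M = pts X"
  define d where "d = feat_dist X"
  define T where "T = feat_topology X"
  have X: "feats X \<noteq> {}" "feats X \<subseteq> extensional M"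
      "\<forall>x\<in>M. \<forall>y\<in>M. bdd_above ((\<lambda>f. \<bar>f x - f y\<bar>) ` feats X)"
    and msX: "Metric_space M d"
    and complX: "Metric_space.mcomplete M d"
    and sepX: "separable_space T"
    and spX: "space (law X) = M"
    and setsX: "sets (law X) = sigma_sets M {U. openin T U}"
    and probX: "prob_space (law X)"
    and suppX: "\<forall>U. openin T U \<and> U \<noteq> {} \<longrightarrow> emeasure (law X) U > 0"
    using assms unfolding geometric_data_set_def M_def d_def T_def
    by - ((elim conjE, assumption)+)
  interpret X: Metric_space M d by (fact msX)
  have T: "T = X.mtopology" unfolding T_def feat_topology_def M_def d_def ..
  have topT [simp]: "topspace T = M" unfolding T by simp
  obtain \<psi> :: "'a \<Rightarrow> real" where \<psi>: "inj_on \<psi> M"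
    using ex_inj_on_separable_metric[OF msX] sepX unfolding T by metis
  define g where "g = inv_into M \<psi>"
  define N where "N = \<psi> ` M"
  have g\<psi> [simp]: "g (\<psi> x) = x" if "x \<in> M" for x
    unfolding g_def using \<psi> that by simp
  have \<psi>g [simp]: "\<psi> (g y) = y" "g y \<in> M" if "y \<in> N" for y
    using that unfolding g_def N_def by (auto simp: f_inv_into_f inv_into_into)
  have \<psi>N [simp]: "\<psi> x \<in> N" if "x \<in> M" for x using that unfolding N_def by simp
  define \<O> where "\<O> = {V. V \<subseteq> N \<and> openin T (g ` V)}"
  define Y where "Y = \<lparr>pts = N, feats = (\<lambda>f. compose N f g) ` feats X,
                       law = distr (law X) (sigma N \<O>) \<psi>\<rparr>"
  have ptsY [simp]: "pts Y = N" unfolding Y_def by simp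
  have featsY: "feats Y = (\<lambda>f. compose N f g) ` feats X" unfolding Y_def by simp
  have lawY: "law Y = distr (law X) (sigma N \<O>) \<psi>" unfolding Y_def by simp
  have dY: "feat_dist Y x y = (if x \<in> N \<and> y \<in> N then d (g x) (g y) else 0)" for x y
    unfolding feat_dist_def d_def featsY using \<psi>g(2)
    by (auto simp: image_image compose_eq M_def[symmetric])
  have msY: "Metric_space N (feat_dist Y)"
  proof
    show "0 \<le> feat_dist Y x y" for x y by (simp add: dY)
    show "feat_dist Y x y = feat_dist Y y x" for x y by (simp add: dY X.commute)
    show "feat_dist Y x y = 0 \<longleftrightarrow> x = y" if "x \<in> N" "y \<in> N" for x y
      using that by (auto simp: dY) (metis \<psi>g(1))
    show "feat_dist Y x z \<le> feat_dist Y x y + feat_dist Y y z"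
      if "x \<in> N" "y \<in> N" "z \<in> N" for x y z
      using that by (simp add: dY X.triangle)
  qed
  interpret Y: Metric_space N "feat_dist Y" by (fact msY)
  define S where "S = feat_topology Y"
  have S: "S = Y.mtopology" unfolding S_def feat_topology_def by simp
  have openS: "openin S V \<longleftrightarrow> V \<in> \<O>" for V
  proof -
    have "g ` Y.mball y r = X.mball (g y) r" if "y \<in> N" for y r
    proof
      show "g ` Y.mball y r \<subseteq> X.mball (g y) r" using that by (auto simp: dY)
      show "X.mball (g y) r \<subseteq> g ` Y.mball y r"
      proof
        fix x assume "x \<in> X.mball (g y) r"
        then show "x \<in> g ` Y.mball y r" using that
          by (intro image_eqI[of _ _ "\<psi> x"]) (auto simp: dY)
      qed
    qed
    note ball = this
    have "A \<subseteq> B \<longleftrightarrow> g ` A \<subseteq> g ` B" if "A \<subseteq> N" "B \<subseteq> N" for A B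
    proof
      assume *: "g ` A \<subseteq> g ` B"
      show "A \<subseteq> B"
      proof
        fix a assume a: "a \<in> A"
        with * obtain b where "b \<in> B" "g a = g b" by blast
        moreover have "\<psi> (g a) = a" "\<psi> (g b) = b" using a \<open>b \<in> B\<close> that by auto
        ultimately show "a \<in> B" by metis
      qed
    qed blast
    note sub = this
    have ball': "Y.mball y r \<subseteq> V \<longleftrightarrow> X.mball (g y) r \<subseteq> g ` V" if "V \<subseteq> N" "y \<in> N" for y r V
      using sub[OF Y.mball_subset_mspace that(1)] ball[OF that(2)] by simp
    have "openin S V \<longleftrightarrow> V \<subseteq> N \<and> (\<forall>y\<in>V. \<exists>r>0. X.mball (g y) r \<subseteq> g ` V)"
      unfolding S Y.openin_mtopology using ball' by (meson subsetD)
    also have "\<dots> \<longleftrightarrow> V \<in> \<O>"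
      unfolding \<O>_def T X.openin_mtopology using \<psi>g(2) by auto
    finally show ?thesis .
  qed
  have openT: "openin T U \<longleftrightarrow> U \<subseteq> M \<and> \<psi> ` U \<in> \<O>" for U
  proof -
    have "g ` \<psi> ` U = U" if "U \<subseteq> M" using that by (force simp: image_image)
    moreover have "\<psi> ` U \<subseteq> N" if "U \<subseteq> M" using that by auto
    ultimately show ?thesis unfolding \<O>_def using openin_subset[of T U] by auto
  qed
  have hom: "homeomorphic_maps T S \<psi> g"
  proof -
    have "continuous_map T S \<psi>"
      unfolding continuous_map_def
    proof (intro conjI allI impI)
      show "\<psi> \<in> topspace T \<rightarrow> topspace S" by (auto simp: S)
      fix V assume "openin S V"
      then have V: "V \<subseteq> N" "openin T (g ` V)" unfolding openS \<O>_def by auto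
      have "{x \<in> topspace T. \<psi> x \<in> V} = g ` V"
        using V(1) by (force intro: image_eqI[of _ g "\<psi> _"])
      with V show "openin T {x \<in> topspace T. \<psi> x \<in> V}" by simp
    qed
    moreover have "continuous_map S T g"
      unfolding continuous_map_def
    proof (intro conjI allI impI)
      show "g \<in> topspace S \<rightarrow> topspace T" by (auto simp: S)
      fix U assume U: "openin T U"
      then have "U \<subseteq> M" "\<psi> ` U \<in> \<O>" unfolding openT by auto
      moreover have "{y \<in> topspace S. g y \<in> U} = \<psi> ` U"
        using \<open>U \<subseteq> M\<close> by (force simp: S intro: image_eqI[of _ \<psi> "g _"])
      ultimately show "openin S {y \<in> topspace S. g y \<in> U}" by (simp add: openS)
    qed
    ultimately show ?thesis unfolding homeomorphic_maps_def by (auto simp: S)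
  qed
  have \<O>sub: "\<O> \<subseteq> Pow N" unfolding \<O>_def by auto
  have meas: "\<psi> \<in> law X \<rightarrow>\<^sub>M sigma N \<O>"
  proof (rule measurable_measure_of[OF \<O>sub])
    show "\<psi> \<in> space (law X) \<rightarrow> N" by (auto simp: spX)
    fix V assume "V \<in> \<O>"
    then have "openin T {x \<in> topspace T. \<psi> x \<in> V}"
      using hom unfolding homeomorphic_maps_def continuous_map_def openS by blast
    moreover have "{x \<in> topspace T. \<psi> x \<in> V} = \<psi> -` V \<inter> space (law X)" by (auto simp: spX)
    ultimately show "\<psi> -` V \<inter> space (law X) \<in> sets (law X)"
      unfolding setsX by auto
  qed
  interpret PX: prob_space "law X" by (fact probX)
  have spY: "space (law Y) = N" unfolding lawY using \<O>sub by (simp add: space_measure_of_conv)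
  have setsY: "sets (law Y) = sigma_sets N {V. openin S V}"
    unfolding lawY openS using \<O>sub by simp
  have "Y.mcomplete"
    unfolding Y.mcomplete_def
  proof (intro allI impI)
    fix \<sigma> assume \<sigma>: "Y.MCauchy \<sigma>"
    have \<sigma>N: "\<sigma> n \<in> N" for n using \<sigma> unfolding Y.MCauchy_def by auto
    have "X.MCauchy (g \<circ> \<sigma>)"
      using \<sigma> \<sigma>N unfolding Y.MCauchy_def X.MCauchy_def by (auto simp: dY)
    then obtain x where "limitin T (g \<circ> \<sigma>) x sequentially"
      using complX unfolding T X.mcomplete_def by blast
    then have "limitin S (\<psi> \<circ> (g \<circ> \<sigma>)) (\<psi> x) sequentially"
      using hom unfolding homeomorphic_maps_def by (meson continuous_map_limit)
    moreover have "\<psi> \<circ> (g \<circ> \<sigma>) = \<sigma>" using \<sigma>N by auto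
    ultimately show "\<exists>y. limitin Y.mtopology \<sigma> y sequentially" by (auto simp: S)
  qed
  moreover have "separable_space S"
    using sepX hom homeomorphic_separable_space homeomorphic_space_def by metis
  moreover have "emeasure (law Y) V > 0" if V: "openin S V" "V \<noteq> {}" for V
  proof -
    have "openin T (\<psi> -` V \<inter> space (law X))" "\<psi> -` V \<inter> space (law X) \<noteq> {}"
    proof -
      have "{x \<in> topspace T. \<psi> x \<in> V} = \<psi> -` V \<inter> space (law X)" by (auto simp: spX)
      then show "openin T (\<psi> -` V \<inter> space (law X))"
        using hom V unfolding homeomorphic_maps_def continuous_map_def by metis
      obtain y where "y \<in> V" using V by blast
      moreover have "y \<in> N" using \<open>y \<in> V\<close> V(1) unfolding openS \<O>_def by auto
      ultimately have "g y \<in> \<psi> -` V \<inter> space (law X)" by (simp add: spX)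
      then show "\<psi> -` V \<inter> space (law X) \<noteq> {}" by blast
    qed
    moreover have "V \<in> sets (sigma N \<O>)"
      using V \<O>sub by (auto simp: openS)
    ultimately show ?thesis
      using suppX unfolding lawY by (simp add: emeasure_distr[OF meas])
  qed
  moreover have "prob_space (law Y)" unfolding lawY by (rule PX.prob_space_distr[OF meas])
  moreover have "feats Y \<subseteq> extensional N"
    unfolding featsY by (auto simp: compose_def)
  moreover have "bdd_above ((\<lambda>f. \<bar>f x - f y\<bar>) ` feats Y)" if "x \<in> N" "y \<in> N" for x y
    using that X by (simp add: featsY image_image compose_eq)
  moreover have "feats Y \<noteq> {}" using X by (simp add: featsY)
  ultimately have gdsY: "geometric_data_set Y"
    unfolding geometric_data_set_def S_def[symmetric] ptsY
    using msY spY setsY by (intro conjI ballI allI impI; (elim conjE)?; simp)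

  let ?PX = "product_topology (\<lambda>_. euclideanreal) M"
  let ?PY = "product_topology (\<lambda>_. euclideanreal) N"
  have hom': "homeomorphic_maps ?PY ?PX (\<lambda>f. compose M f \<psi>) (\<lambda>f. compose N f g)"
    unfolding homeomorphic_maps_def
  proof (intro conjI ballI)
    show "continuous_map ?PY ?PX (\<lambda>f. compose M f \<psi>)"
      unfolding continuous_map_componentwise
      by (auto simp: compose_def intro!: continuous_map_product_projection)
    show "continuous_map ?PX ?PY (\<lambda>f. compose N f g)"
      unfolding continuous_map_componentwise
      by (auto simp: compose_def intro!: continuous_map_product_projection)
    show "compose N (compose M f \<psi>) g = f" if "f \<in> topspace ?PY" for f
      using that by (auto simp: compose_def fun_eq_iff PiE_def extensional_def)
    show "compose M (compose N f g) \<psi> = f" if "f \<in> topspace ?PX" for f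
      using that by (auto simp: compose_def fun_eq_iff PiE_def extensional_def)
  qed
  have "homeomorphic_map ?PY ?PX (\<lambda>f. compose M f \<psi>)"
    using hom' homeomorphic_map_maps by blast
  moreover have "feats Y \<subseteq> topspace ?PY"
    by (auto simp: featsY compose_def PiE_def)
  ultimately have "(\<lambda>f. compose M f \<psi>) ` feat_closure Y
      = ?PX closure_of ((\<lambda>f. compose M f \<psi>) ` feats Y)"
    unfolding feat_closure_def ptsY by (metis homeomorphic_map_closure_of)
  also have "(\<lambda>f. compose M f \<psi>) ` feats Y = feats X"
  proof -
    have "compose M (compose N f g) \<psi> = f" if "f \<in> feats X" for f
      using that X by (auto simp: compose_def fun_eq_iff extensional_def)
    then show ?thesis by (force simp: featsY image_image)
  qed
  finally have "(\<lambda>f. compose M f \<psi>) ` feat_closure Y = feat_closure X"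
    by (simp add: feat_closure_def M_def)
  moreover have "bij_betw \<psi> M N" using \<psi> unfolding N_def by (rule inj_on_imp_bij_betw)
  moreover have "\<psi> \<in> law X \<rightarrow>\<^sub>M law Y" using meas unfolding lawY by simp
  moreover have "distr (law X) (law Y) \<psi> = law Y"
    unfolding lawY by (rule distr_cong) auto
  ultimately have "isomorphic X Y"
    unfolding isomorphic_def M_def ptsY by blast
  with gdsY show ?thesis by blast
qed

text \<open>Complete separable metric spaces have at most the cardinality of the continuum, so every
  geometric data set is isomorphic to one whose points are real numbers (with a metric unrelated
  to that of the line); see \<open>ex_isomorphic_real_data_set\<close>.  A set of isomorphism
  classes is represented by the union of its classes, that is, by an isomorphism-invariant set of
  geometric data sets over \<^typ>\<open>real\<close>.\<close>

definition L_data_sets :: "(real \<Rightarrow> real) set \<Rightarrow> real data_set set" where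
  "L_data_sets \<L> = {X. geometric_data_set X \<and> L_compact \<L> X}"

definition iso_classes_in :: "real data_set set \<Rightarrow> (real \<Rightarrow> real) set \<Rightarrow> bool" where
  "iso_classes_in \<P> \<L> \<longleftrightarrow>
     \<P> \<subseteq> L_data_sets \<L> \<and>
     (\<forall>X\<in>\<P>. \<forall>Y\<in>L_data_sets \<L>. isomorphic X Y \<longrightarrow> Y \<in> \<P>)"

definition box_closed_in :: "real data_set set \<Rightarrow> (real \<Rightarrow> real) set \<Rightarrow> bool" where
  "box_closed_in \<P> \<L> \<longleftrightarrow>
     (\<forall>X \<in> L_data_sets \<L> - \<P>. \<exists>\<epsilon>>0. \<forall>Y\<in>L_data_sets \<L>. box_dist X Y < \<epsilon> \<longrightarrow> Y \<notin> \<P>)"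

definition L_pyramid :: "(real \<Rightarrow> real) set \<Rightarrow> real data_set set \<Rightarrow> bool" where
  "L_pyramid \<L> \<P> \<longleftrightarrow>
     iso_classes_in \<P> \<L> \<and>
     (\<forall>X\<in>L_data_sets \<L>. \<forall>Y\<in>\<P>. X \<preceq>\<^sub>D Y \<longrightarrow> X \<in> \<P>) \<and>
     (\<forall>X\<in>\<P>. \<forall>Y\<in>\<P>. \<exists>Z\<in>\<P>. X \<preceq>\<^sub>D Z \<and> Y \<preceq>\<^sub>D Z) \<and>
     \<P> \<noteq> {} \<and> box_closed_in \<P> \<L>"

definition weakly_converges ::
    "(real \<Rightarrow> real) set \<Rightarrow> (nat \<Rightarrow> real data_set set) \<Rightarrow> real data_set set \<Rightarrow> bool" where
  "weakly_converges \<L> \<P>s \<P> \<longleftrightarrow>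
     (\<forall>n. iso_classes_in (\<P>s n) \<L> \<and> box_closed_in (\<P>s n) \<L>) \<and>
     iso_classes_in \<P> \<L> \<and> box_closed_in \<P> \<L> \<and>
     (\<forall>X\<in>\<P>. (\<lambda>n. box_dist_set X (\<P>s n)) \<longlonglongrightarrow> 0) \<and>
     (\<forall>X\<in>L_data_sets \<L> - \<P>. liminf (\<lambda>n. box_dist_set X (\<P>s n)) > 0)"

text \<open>The library's \<^const>\<open>diameter\<close> is real-valued and \<open>0\<close> on unbounded sets, hence the
  extended version.\<close>

definition ediam :: "real set \<Rightarrow> ennreal" where
  "ediam I = (SUP x\<in>I. SUP y\<in>I. ennreal (dist x y))"

definition part_diam :: "real measure \<Rightarrow> real \<Rightarrow> ennreal" where
  "part_diam \<mu> \<alpha> = (INF I \<in> {I \<in> sets borel. measure \<mu> I \<ge> \<alpha>}. ediam I)"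

text \<open>\<open>obs_diam X \<kappa>\<close> is what is usually written \<open>ObsDiam(X; -\<kappa>)\<close>: the sign belongs to
  the notation and is dropped here.\<close>

definition obs_diam :: "'a data_set \<Rightarrow> real \<Rightarrow> ennreal" where
  "obs_diam X \<kappa> = (SUP f\<in>feats X. part_diam (distr (law X) borel f) (1 - \<kappa>))"

definition ObsDiam :: "'a data_set set \<Rightarrow> real \<Rightarrow> ennreal" where
  "ObsDiam \<E> \<kappa> = (SUP X\<in>\<E>. obs_diam X \<kappa>)"

end

theory Submission
  imports Defs
begin

text \<open>A \<open>Lip1\<close>-pyramid is determined, as far as the observable diameter is concerned, by the laws
  \<open>\<mu>\<close> on the line for which it contains the data set \<open>(supp \<mu>, Lip1, \<mu>)\<close>: push-forwards of members of
  the pyramid under features are such laws.  That the observable diameter of the limit is not too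
  large follows by transporting features through almost optimal couplings, together with the right
  continuity of \<open>\<kappa> \<mapsto> PartDiam(\<mu>; 1 - \<kappa>)\<close>.  Conversely, laws in \<open>\<P>s n\<close> with large partial diameter
  need not be tight; but each can be compressed by a monotone 1-Lipschitz map into a bounded interval,
  the same for all \<open>n\<close>, without making the partial diameter small.  A weak limit of the compressed laws
  is close in box distance to members of \<open>\<P>s n\<close>, by Skorohod's coupling, hence belongs to \<open>\<P>\<close>.\<close>

section \<open>Partial diameter\<close>

text \<open>A coupling costs mass as well as diameter: if two random variables differ by more than
  \<delta> only on an event of mass \<eta>, their partial diameters compare up to
  \<open>2 * \<delta>\<close>, but at levels that differ by \<eta>. The shift by \<epsilon> pays for
  this mass. In the upper bound the gap between \<kappa> and \<kappa> + \<epsilon> absorbs it, so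
  that the inequality holds for each fixed \<epsilon>, before any limit. In the lower bound the
  shift goes the wrong way, and right continuity has to make room first. Laws on the line suffice
  because \<open>L_compact\<close> makes \<open>p \<circ> f\<close> a limit of features again
  whenever \<open>f\<close> is one and \<open>p\<close> is 1-Lipschitz. The same fact keeps
  compressed laws inside the pyramid. Tightness may fail because several clumps of mass drift apart,
  which no translation repairs. But at most 2 / \<alpha> quantiles are needed to meet every interval
  of mass above \<alpha> / 2, and a stretch of length 2D around each of them is all that has to be
  kept; hence the length \<open>2 * D * nat \<lfloor>2 / \<alpha>\<rfloor>\<close>.\<close>

lemma part_diam_le:
  assumes "a \<le> b" "\<alpha> \<le> measure \<mu> {a..b}"
  shows "part_diam \<mu> \<alpha> \<le> ennreal (b - a)"
proof -
  have "part_diam \<mu> \<alpha> \<le> ediam {a..b}"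
    unfolding part_diam_def using assms by (intro INF_lower) auto
  also have "\<dots> \<le> ennreal (b - a)"
    unfolding ediam_def by (intro SUP_least ennreal_leI) (auto simp: dist_real_def)
  finally show ?thesis .
qed

lemma part_diam_mono: "\<alpha> \<le> \<beta> \<Longrightarrow> part_diam \<mu> \<alpha> \<le> part_diam \<mu> \<beta>"
  unfolding part_diam_def by (intro INF_superset_mono) auto

text \<open>Passing from a Borel set to the interval between its infimum and supremum keeps the
  diameter, so nearly optimal sets may be taken to be compact intervals. Positivity of \<alpha>
  excludes the empty set.\<close>

lemma part_diam_lessE:
  assumes "0 < \<alpha>" "part_diam \<mu> \<alpha> < c" "sets \<mu> = sets borel" "finite_measure \<mu>"
  obtains a b where "a \<le> b" "\<alpha> \<le> measure \<mu> {a..b}" "ennreal (b - a) < c"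
proof -
  interpret finite_measure \<mu> by fact
  obtain I where I: "I \<in> sets borel" "\<alpha> \<le> measure \<mu> I" "ediam I < c"
    using assms(2) unfolding part_diam_def INF_less_iff by auto
  define D where "D = enn2real (ediam I)"
  have "ediam I < top" using order_less_le_trans[OF I(3) top_greatest] .
  then have D: "ennreal D = ediam I" unfolding D_def by simp
  have "I \<noteq> {}" using I(2) assms(1) by auto
  then obtain x0 where x0: "x0 \<in> I" by blast
  have dist: "dist x y \<le> D" if "x \<in> I" "y \<in> I" for x y
  proof -
    have "ennreal (dist x y) \<le> ennreal D"
      unfolding D ediam_def using that by (meson SUP_upper SUP_upper2)
    then show ?thesis using enn2real_nonneg[of "ediam I"] by (simp add: D_def)
  qed
  have bdd: "bdd_below I" "bdd_above I"
    using dist[OF x0] unfolding bdd_below_def bdd_above_def dist_real_def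
    by (fastforce intro!: exI[of _ "x0 - D"], fastforce intro!: exI[of _ "x0 + D"])
  have sub: "I \<subseteq> {Inf I..Sup I}" using bdd by (auto intro: cInf_lower cSup_upper)
  have "Sup I \<le> Inf I + D"
  proof (rule cSup_least[OF \<open>I \<noteq> {}\<close>])
    fix x assume x: "x \<in> I"
    have "x - D \<le> Inf I"
      using dist[OF x] by (intro cInf_greatest[OF \<open>I \<noteq> {}\<close>]) (fastforce simp: dist_real_def)
    then show "x \<le> Inf I + D" by simp
  qed
  then have "ennreal (Sup I - Inf I) \<le> ennreal D" by (intro ennreal_leI) simp
  then have "ennreal (Sup I - Inf I) < c" using I(3) D by simp
  moreover have "\<alpha> \<le> measure \<mu> {Inf I..Sup I}"
    using I(2) finite_measure_mono[OF sub] assms(3) by simp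
  moreover have "Inf I \<le> Sup I" using sub x0 by force
  ultimately show thesis using that by blast
qed

text \<open>An interval that is good for \<open>u\<close>, widened by \<delta> at both ends,
  contains \<open>v\<close> wherever it contains \<open>u\<close>, except on the event of mass at
  most \<eta>.\<close>

lemma part_diam_perturb:
  assumes "prob_space M" and [measurable]: "u \<in> borel_measurable M" "v \<in> borel_measurable M"
    and "0 \<le> \<delta>" "0 < \<alpha>" "measure M {x \<in> space M. \<delta> < \<bar>u x - v x\<bar>} \<le> \<eta>"
  shows "part_diam (distr M borel v) \<alpha> \<le> part_diam (distr M borel u) (\<alpha> + \<eta>) + ennreal (2 * \<delta>)"
proof -
  interpret prob_space M by fact
  interpret u: prob_space "distr M borel u" by (rule prob_space_distr) simp
  have "0 \<le> \<eta>" using assms(6) measure_nonneg order_trans by blast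
  \<comment> \<open>With the diameter error subtracted on the left, the right side stands alone and
    can be approached by values \<open>c\<close> strictly above it.\<close>
  have "part_diam (distr M borel v) \<alpha> - ennreal (2 * \<delta>) \<le> part_diam (distr M borel u) (\<alpha> + \<eta>)"
  proof (rule dense_ge)
    fix c assume "part_diam (distr M borel u) (\<alpha> + \<eta>) < c"
    then obtain a b where ab: "a \<le> b" "\<alpha> + \<eta> \<le> measure (distr M borel u) {a..b}"
        "ennreal (b - a) < c"
      using \<open>0 < \<alpha>\<close> \<open>0 \<le> \<eta>\<close> u.finite_measure_axioms
      by (metis add_pos_nonneg part_diam_lessE sets_distr)
    have "\<alpha> + \<eta> \<le> measure M {x \<in> space M. u x \<in> {a..b}}"
      using ab(2) by (simp add: measure_distr vimage_def Int_def conj_commute)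
    also have "\<dots> \<le> measure M ({x \<in> space M. v x \<in> {a - \<delta>..b + \<delta>}} \<union> {x \<in> space M. \<delta> < \<bar>u x - v x\<bar>})"
      by (intro finite_measure_mono) (auto simp: abs_real_def)
    also have "\<dots> \<le> measure M {x \<in> space M. v x \<in> {a - \<delta>..b + \<delta>}} + \<eta>"
      using measure_Un_le[of "{x \<in> space M. v x \<in> {a - \<delta>..b + \<delta>}}" M
          "{x \<in> space M. \<delta> < \<bar>u x - v x\<bar>}"] assms(6) by simp
    finally have "\<alpha> \<le> measure (distr M borel v) {a - \<delta>..b + \<delta>}"
      by (simp add: measure_distr vimage_def Int_def conj_commute)
    then have "part_diam (distr M borel v) \<alpha> \<le> ennreal (b + \<delta> - (a - \<delta>))"
      using ab(1) \<open>0 \<le> \<delta>\<close> by (intro part_diam_le) auto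
    also have "\<dots> = ennreal (b - a) + ennreal (2 * \<delta>)"
      using ab(1) \<open>0 \<le> \<delta>\<close> by (simp flip: ennreal_plus add: algebra_simps)
    also have "\<dots> \<le> ennreal (2 * \<delta>) + c" using ab(3) by (simp add: add.commute add_mono)
    finally show "part_diam (distr M borel v) \<alpha> - ennreal (2 * \<delta>) \<le> c"
      by (simp add: ennreal_minus_le_iff)
  qed
  then show ?thesis by (simp add: ennreal_minus_le_iff add.commute)
qed

lemma (in real_distribution) ex_large_interval:
  assumes "0 < e" obtains R where "0 \<le> R" "1 - e < measure M {-R..R}"
proof -
  have "(\<lambda>n. measure M {-real n..real n}) \<longlonglongrightarrow> measure M (\<Union>n. {-real n..real n})"
    by (rule finite_Lim_measure_incseq) (auto simp: incseq_def)
  moreover have "(\<Union>n. {-real n..real n}) = UNIV"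
  proof -
    have "\<exists>n. -real n \<le> x \<and> x \<le> real n" for x
      using real_arch_simple[of "\<bar>x\<bar>"] by (auto simp: abs_le_iff minus_le_iff)
    then show ?thesis by auto
  qed
  ultimately have "(\<lambda>n. measure M {-real n..real n}) \<longlonglongrightarrow> 1"
    using prob_space by simp
  then have "eventually (\<lambda>n. 1 - e < measure M {-real n..real n}) sequentially"
    using assms by (intro order_tendstoD) auto
  then obtain n where "1 - e < measure M {-real n..real n}"
    using eventually_happens by force
  then show thesis using that[of "real n"] by simp
qed

text \<open>Left continuity in the mass level, that is, right continuity in \<kappa>. Nearly optimal
  intervals for levels increasing to \<alpha> all meet one compact set, since they carry too much
  mass to escape; a limit of their left endpoints gives an interval of length \<open>D\<close> and
  mass at least \<alpha>.\<close>

lemma (in real_distribution) part_diam_right_cont: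
  assumes "0 < \<alpha>" "c < part_diam M \<alpha>"
  shows "\<exists>\<eta>>0. \<eta> < \<alpha> \<and> c < part_diam M (\<alpha> - \<eta>)"
proof (rule ccontr)
  assume "\<not> ?thesis"
  then have le: "part_diam M (\<alpha> - \<eta>) \<le> c" if "0 < \<eta>" "\<eta> < \<alpha>" for \<eta>
    using that by (meson not_le)
  define D where "D = enn2real c"
  have "c < top" using order_less_le_trans[OF assms(2) top_greatest] .
  then have D: "c = ennreal D" "0 \<le> D" unfolding D_def by simp_all
  \<comment> \<open>The bound \<alpha> / 2 leaves each interval a mass of at least \<alpha> / 2, too
    much to be disjoint from \<open>{-R..R}\<close>, whose mass exceeds 1 - \<alpha> / 2.\<close>
  define e where "e n = \<alpha> / 2 / real (Suc n)" for n
  have e: "0 < e n" "e n \<le> \<alpha> / 2" "e n < \<alpha>" for n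
    unfolding e_def using assms(1) by (auto simp: field_simps add_pos_nonneg)
  have e_mono: "e n \<le> e m" if "m \<le> n" for m n
    unfolding e_def using assms(1) that by (intro divide_left_mono) auto
  have e0: "e \<longlonglongrightarrow> 0" unfolding e_def using LIMSEQ_Suc[OF lim_const_over_n[of "\<alpha> / 2"]] by simp
  have "\<exists>a b. a \<le> b \<and> \<alpha> - e n \<le> measure M {a..b} \<and> b - a < D + e n" for n
  proof -
    have "part_diam M (\<alpha> - e n) < ennreal (D + e n)"
      using le[OF e(1)[of n] e(3)[of n]] D e(1)[of n] by (intro order.strict_trans1[OF _ ennreal_lessI]) auto
    then obtain a b where "a \<le> b" "\<alpha> - e n \<le> measure M {a..b}" "ennreal (b - a) < ennreal (D + e n)"
      using part_diam_lessE[of "\<alpha> - e n" M] e(3)[of n] finite_measure_axioms events_eq_borel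
      by (metis diff_gt_0_iff_gt)
    then show ?thesis by (auto simp: ennreal_less_iff)
  qed
  then obtain a b where ab: "\<And>n. a n \<le> b n" "\<And>n. \<alpha> - e n \<le> measure M {a n..b n}"
      "\<And>n. b n - a n < D + e n"
    by metis
  obtain R where R: "0 \<le> R" "1 - \<alpha> / 2 < measure M {-R..R}"
    using ex_large_interval[of "\<alpha> / 2"] assms(1) by auto
  have meet: "{a n..b n} \<inter> {-R..R} \<noteq> {}" for n
  proof
    assume "{a n..b n} \<inter> {-R..R} = {}"
    then have "measure M {a n..b n} + measure M {-R..R} = measure M ({a n..b n} \<union> {-R..R})"
      by (intro finite_measure_Union[symmetric]) auto
    also have "\<dots> \<le> 1" by (rule prob_le_1)
    finally show False using R(2) ab(2)[of n] e(2)[of n] by simp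
  qed
  have "a n \<in> {-R - D - \<alpha>..R}" for n
    using meet[of n] ab(3)[of n] e(3)[of n] by auto
  then obtain l r where l: "strict_mono (r :: nat \<Rightarrow> nat)" "(a \<circ> r) \<longlonglongrightarrow> l"
    using seq_compactE[OF compact_imp_seq_compact[OF compact_Icc]] by metis
  have ge: "\<alpha> \<le> measure M {l - d..l + D + d}" if "0 < d" for d
  proof -
    have "eventually (\<lambda>n. \<bar>a (r n) - l\<bar> < d / 2) sequentially"
      using l(2) that by (auto dest!: tendstoD[where e = "d / 2"] simp: dist_real_def)
    moreover have er: "(\<lambda>n. e (r n)) \<longlonglongrightarrow> 0"
      using LIMSEQ_subseq_LIMSEQ[OF e0 l(1)] by (simp add: o_def)
    then have "eventually (\<lambda>n. e (r n) < d / 2) sequentially"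
      using that by (intro order_tendstoD) auto
    ultimately have ev: "eventually (\<lambda>n. \<alpha> - e (r n) \<le> measure M {l - d..l + D + d}) sequentially"
    proof eventually_elim
      case (elim n)
      then have "{a (r n)..b (r n)} \<subseteq> {l - d..l + D + d}"
        using ab(3)[of "r n"] by (auto simp: abs_if field_simps split: if_splits)
      then show ?case by (intro order_trans[OF ab(2) finite_measure_mono]) auto
    qed
    have "(\<lambda>n. \<alpha> - e (r n)) \<longlonglongrightarrow> \<alpha> - 0" by (intro tendsto_intros er)
    then show ?thesis using tendsto_upperbound[OF _ ev] by simp
  qed
  \<comment> \<open>The margin \<open>d\<close> was fixed while the subsequence ran; only now does
    it shrink, by continuity from above along closed intervals.\<close>
  have "(\<lambda>n. measure M {l - e n..l + D + e n}) \<longlonglongrightarrow> measure M (\<Inter>n. {l - e n..l + D + e n})"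
    using e_mono by (intro finite_Lim_measure_decseq) (auto simp: decseq_def intro!: add_mono diff_mono)
  moreover have "(\<Inter>n. {l - e n..l + D + e n}) = {l..l + D}"
  proof (intro equalityI subsetI)
    fix x assume "x \<in> (\<Inter>n. {l - e n..l + D + e n})"
    then have x: "l - e n \<le> x" "x \<le> l + D + e n" for n by auto
    have "(\<lambda>n. l - e n) \<longlonglongrightarrow> l - 0" "(\<lambda>n. l + D + e n) \<longlonglongrightarrow> l + D + 0"
      by (intro tendsto_intros e0)+
    then show "x \<in> {l..l + D}"
      using x by (auto intro: LIMSEQ_le_const LIMSEQ_le_const2)
  next
    fix x assume x: "x \<in> {l..l + D}"
    have "l - e n \<le> x \<and> x \<le> l + D + e n" for n
      using e(1)[of n] x by simp
    then show "x \<in> (\<Inter>n. {l - e n..l + D + e n})" by simp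
  qed
  ultimately have "\<alpha> \<le> measure M {l..l + D}"
    using ge e(1) by (intro LIMSEQ_le_const) auto
  then have "part_diam M \<alpha> \<le> ennreal (l + D - l)" using D(2) by (intro part_diam_le) auto
  then show False using assms(2) D by simp
qed

section \<open>Compression into a bounded interval\<close>

lemma Lip1_iff: "p \<in> Lip1 \<longleftrightarrow> (\<forall>x y. \<bar>p x - p y\<bar> \<le> \<bar>x - y\<bar>)"
  by (simp add: Lip1_def lipschitz_on_def dist_real_def)

lemma ident_Lip1: "(\<lambda>x. x) \<in> Lip1"
  by (simp add: Lip1_iff)

lemma Lip1_continuous: "p \<in> Lip1 \<Longrightarrow> continuous_on UNIV p"
  unfolding Lip1_def by (auto intro: lipschitz_on_continuous_on)

lemma Lip1_measurable: "p \<in> Lip1 \<Longrightarrow> p \<in> borel_measurable borel"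
  by (intro borel_measurable_continuous_onI Lip1_continuous)

text \<open>The points are the quantiles of orders \<beta>, 2\<beta>, and so on up to 1. Across an
  interval of mass above \<beta> the distribution function must pass a multiple of \<beta>, and the
  corresponding quantile lies in the interval.\<close>

lemma (in real_distribution) ex_quantiles:
  assumes "0 < \<beta>"
  shows "\<exists>T. finite T \<and> card T \<le> nat \<lfloor>1 / \<beta>\<rfloor> \<and> (\<forall>a b. a \<le> b \<longrightarrow> \<beta> < prob {a..b} \<longrightarrow> T \<inter> {a..b} \<noteq> {})"
proof -
  define u where "u i = real i * \<beta>" for i :: nat
  \<comment> \<open>For order 1 and a law unbounded to the right the set is empty and
    \<open>Inf\<close> has an unspecified value. This is harmless: the quantile is used below only
    when \<open>u i \<le> cdf M b\<close>.\<close>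
  define T where "T = (\<lambda>i. Inf {x. u i \<le> cdf M x}) ` {1..nat \<lfloor>1 / \<beta>\<rfloor>}"
  have "T \<inter> {a..b} \<noteq> {}" if ab: "a \<le> b" "\<beta> < prob {a..b}" for a b
  proof -
    \<comment> \<open>The largest multiple of \<beta> not exceeding \<open>cdf M b\<close>; it
      exceeds the mass to the left of \<open>a\<close> because \<open>{a..b}\<close> has mass above
      \<beta>.\<close>
    define i where "i = nat \<lfloor>cdf M b / \<beta>\<rfloor>"
    have nn: "0 \<le> cdf M b / \<beta>" using assms by (simp add: cdf_def)
    have "real i \<le> cdf M b / \<beta>" "cdf M b / \<beta> < real i + 1"
      unfolding i_def using nn by linarith+
    then have i: "u i \<le> cdf M b" "cdf M b < u i + \<beta>"
      using assms by (simp_all add: u_def field_simps)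
    have split: "cdf M b = prob {..<a} + prob {a..b}"
      unfolding cdf_def using ab(1)
      by (subst finite_measure_Union[symmetric]) (auto intro!: arg_cong[where f = prob])
    then have lt: "prob {..<a} < u i" using i ab(2) by simp
    then have "0 < u i" using measure_nonneg le_less_trans by blast
    then have "1 \<le> i" by (cases i) (auto simp: u_def)
    moreover have "cdf M b \<le> 1" by (simp add: cdf_def)
    then have "i \<le> nat \<lfloor>1 / \<beta>\<rfloor>"
      unfolding i_def using assms by (intro nat_mono floor_mono divide_right_mono) auto
    ultimately have T: "Inf {x. u i \<le> cdf M x} \<in> T" unfolding T_def by auto
    have lb: "a \<le> x" if "u i \<le> cdf M x" for x
    proof (rule ccontr)
      assume "\<not> a \<le> x"
      then have "cdf M x \<le> prob {..<a}" unfolding cdf_def by (intro finite_measure_mono) auto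
      then show False using that lt by simp
    qed
    have "Inf {x. u i \<le> cdf M x} \<le> b" using lb i by (intro cInf_lower) (auto simp: bdd_below_def)
    moreover have "a \<le> Inf {x. u i \<le> cdf M x}" using lb i by (intro cInf_greatest) auto
    ultimately show ?thesis using T by auto
  qed
  moreover have "card T \<le> nat \<lfloor>1 / \<beta>\<rfloor>"
    unfolding T_def using card_image_le[of "{1..nat \<lfloor>1 / \<beta>\<rfloor>}"] by simp
  moreover have "finite T" unfolding T_def by simp
  ultimately show ?thesis by blast
qed

text \<open>The map \<open>p\<close> collapses everything except the \<open>D\<close>-neighbourhoods of finitely many quantiles
  of the distribution.  A set of mass at least \<open>\<alpha>\<close> surrounds one of the quantiles, so its image is
  still spread out, while the range of \<open>p\<close> is bounded independently of the distribution.\<close>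

lemma (in real_distribution) ex_Lip1_compression:
  assumes "0 < \<alpha>" "0 \<le> D" "ennreal D < part_diam M \<alpha>"
  shows "\<exists>p\<in>Lip1. range p \<subseteq> {0..2 * D * real (nat \<lfloor>2 / \<alpha>\<rfloor>)} \<and>
           ennreal D \<le> part_diam (distr M borel p) \<alpha>"
proof -
  define N where "N = nat \<lfloor>2 / \<alpha>\<rfloor>"
  \<comment> \<open>Spacing \<alpha> / 2 instead of \<alpha>, because the set of mass \<alpha> met
    below is first truncated to a compact interval and may lose mass up to \<alpha> / 2.\<close>
  obtain T where T: "finite T" "card T \<le> N"
      "\<And>a b. a \<le> b \<Longrightarrow> \<alpha> / 2 < prob {a..b} \<Longrightarrow> T \<inter> {a..b} \<noteq> {}"
    using ex_quantiles[of "\<alpha> / 2"] assms(1) unfolding N_def by auto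
  define E where "E = (\<Union>t\<in>T. {t - D..t + D})"
  \<comment> \<open>An increment of \<open>p\<close> is the length of the part of \<open>E\<close>
    passed over. So \<open>p\<close> is monotone and 1-Lipschitz, and its range is no longer than
    \<open>E\<close>.\<close>
  define p where "p x = measure lborel (E \<inter> {..x})" for x
  have E[measurable]: "E \<in> sets borel" unfolding E_def using T(1) by auto
  have EN: "emeasure lborel E \<le> ennreal (2 * D * N)"
  proof -
    have "emeasure lborel E \<le> (\<Sum>t\<in>T. emeasure lborel {t - D..t + D})"
      unfolding E_def using T(1) by (intro emeasure_subadditive_finite) auto
    also have "\<dots> = (\<Sum>t\<in>T. ennreal (2 * D))" using assms(2) by (intro sum.cong) auto
    also have "\<dots> = ennreal (2 * D * card T)"
      using assms(2) by (simp add: ennreal_mult' ennreal_of_nat_eq_real_of_nat mult.commute)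
    also have "\<dots> \<le> ennreal (2 * D * N)"
      using assms(2) T(2) by (intro ennreal_leI mult_left_mono) auto
    finally show ?thesis .
  qed
  have fin: "F \<in> fmeasurable lborel" if "F \<subseteq> E" "F \<in> sets borel" for F
  proof (rule fmeasurableI)
    have "emeasure lborel F \<le> emeasure lborel E" using that by (intro emeasure_mono) auto
    with EN show "emeasure lborel F < \<infinity>" by (metis order_trans order.strict_trans1 ennreal_less_top infinity_ennreal_def)
  qed (use that in simp)
  have diff: "p y - p x = measure lborel (E \<inter> {x<..y})" if "x \<le> y" for x y
  proof -
    have "E \<inter> {..x} \<inter> (E \<inter> {x<..y}) = {}" by auto
    then have "measure lborel (E \<inter> {..x} \<union> E \<inter> {x<..y}) = p x + measure lborel (E \<inter> {x<..y})"
      unfolding p_def by (intro measure_Un3[THEN trans]) (auto intro!: fin)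
    moreover have "E \<inter> {..x} \<union> E \<inter> {x<..y} = E \<inter> {..y}" using that by auto
    ultimately show ?thesis unfolding p_def by simp
  qed
  have mono: "p x \<le> p y" if "x \<le> y" for x y
  proof -
    have "0 \<le> p y - p x" unfolding diff[OF that] by (rule measure_nonneg)
    then show ?thesis by simp
  qed
  have lip: "p y - p x \<le> y - x" if "x \<le> y" for x y
  proof -
    have "measure lborel (E \<inter> {x<..y}) \<le> measure lborel {x<..y}"
      using that by (intro measure_mono_fmeasurable) (auto simp: fmeasurable_def)
    then show ?thesis using diff[OF that] that by simp
  qed
  have p: "p \<in> Lip1"
    unfolding Lip1_iff
  proof (intro allI)
    fix x y show "\<bar>p x - p y\<bar> \<le> \<bar>x - y\<bar>"
      using mono[of x y] mono[of y x] lip[of x y] lip[of y x] by (cases "x \<le> y") auto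
  qed
  have [measurable]: "p \<in> borel_measurable borel" by (rule Lip1_measurable[OF p])
  have "p x \<le> 2 * D * N" for x
  proof -
    have "p x \<le> measure lborel E"
      unfolding p_def by (intro measure_mono_fmeasurable fin) auto
    also have "\<dots> \<le> 2 * D * N"
      using EN assms(2) enn2real_leI unfolding measure_def by simp
    finally show ?thesis .
  qed
  moreover have "0 \<le> p x" for x unfolding p_def by simp
  moreover have "ennreal D \<le> part_diam (distr M borel p) \<alpha>"
  proof (rule ccontr)
    assume "\<not> ?thesis"
    then obtain c d where cd: "c \<le> d" "\<alpha> \<le> measure (distr M borel p) {c..d}"
        "ennreal (d - c) < ennreal D"
      using part_diam_lessE[of \<alpha> "distr M borel p" "ennreal D"] assms(1)
        prob_space.finite_measure[OF prob_space_distr[of p borel]] by (auto simp: not_le)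
    then have dc: "d - c < D" by (simp add: ennreal_less_iff)
    \<comment> \<open>If the image had too small a partial diameter, the preimage \<open>J\<close>
      of a short interval would have mass at least \<alpha>, hence diameter above \<open>D\<close>
      by the assumption on \<open>M\<close>. It is order-convex by monotonicity of
      \<open>p\<close>.\<close>
    define J where "J = {x. p x \<in> {c..d}}"
    have [measurable]: "J \<in> sets borel" unfolding J_def by measurable
    have closed: "closed J"
      unfolding J_def using continuous_closed_vimage[of "{c..d}" p] Lip1_continuous[OF p]
      by (auto simp: vimage_def continuous_on_eq_continuous_at)
    have between: "z \<in> J" if "x \<in> J" "y \<in> J" "x \<le> z" "z \<le> y" for x y z
      using that mono[of x z] mono[of z y] unfolding J_def by auto
    have J: "\<alpha> \<le> prob J"
      using cd(2) by (simp add: measure_distr vimage_def J_def)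
    have "ennreal D < ediam J"
      using assms(3) unfolding part_diam_def by (rule less_le_trans) (use J in \<open>auto intro: INF_lower\<close>)
    then obtain x y where xy: "x \<in> J" "y \<in> J" "D < dist x y"
      using assms(2) unfolding ediam_def less_SUP_iff by (auto simp: ennreal_less_iff)
    \<comment> \<open>\<open>J\<close> may be a half-line or the whole line, since \<open>p\<close>
      is constant near both ends, while quantiles are found in compact intervals.\<close>
    obtain R where R: "1 - \<alpha> / 2 < prob {-R..R}"
      using ex_large_interval[of "\<alpha> / 2"] assms(1) by auto
    have "prob J \<le> prob (J \<inter> {-R..R}) + prob (- {-R..R})"
      using finite_measure_mono[of J "J \<inter> {-R..R} \<union> - {-R..R}"]
        measure_Un_le[of "J \<inter> {-R..R}" M "- {-R..R}"] by force
    moreover have "prob (- {-R..R}) = 1 - prob {-R..R}"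
      using prob_compl[of "{-R..R}"] by (simp add: Compl_eq_Diff_UNIV)
    ultimately have JR: "\<alpha> / 2 < prob (J \<inter> {-R..R})" using J R by simp
    have "connected (J \<inter> {-R..R})"
      using between by (auto simp: connected_iff_interval)
    moreover have "compact (J \<inter> {-R..R})" using closed by (simp add: closed_Int_compact)
    ultimately obtain A B where AB: "J \<inter> {-R..R} = {A..B}"
      using connected_compact_interval_1 by (metis cbox_interval)
    have "A \<le> B"
    proof (rule ccontr)
      assume "\<not> A \<le> B"
      then show False using JR AB assms(1) by simp
    qed
    then have "T \<inter> {A..B} \<noteq> {}" using T(3)[of A B] JR AB by simp
    then obtain t where t: "t \<in> T" "t \<in> {A..B}" by blast
    \<comment> \<open>Enlarging \<open>{A..B}\<close> by the distant points \<open>x\<close> and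
      \<open>y\<close> gives an interval with ends in \<open>J\<close> that contains a quantile and
      is longer than \<open>D\<close>.\<close>
    define a b where "a = min A (min x y)" and "b = max B (max x y)"
    have "{A, B} \<subseteq> J \<inter> {-R..R}" unfolding AB using \<open>A \<le> B\<close> by simp
    then have AJ: "A \<in> J" "B \<in> J" by simp_all
    have "a \<in> {A, x, y}" "b \<in> {B, x, y}"
      unfolding a_def b_def min_def max_def by simp_all
    moreover have le: "a \<le> A" "a \<le> x" "a \<le> y" "B \<le> b" "x \<le> b" "y \<le> b"
      unfolding a_def b_def by simp_all
    moreover have "D < b - a" using xy(3) le unfolding dist_real_def by arith
    ultimately have ab: "a \<in> J" "b \<in> J" "D < b - a" "a \<le> t" "t \<le> b"
      using AJ xy(1,2) t(2) by (blast, blast, blast, simp_all)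
    \<comment> \<open>An interval around \<open>t\<close> longer than \<open>D\<close> shares a
      length of at least \<open>D\<close> with \<open>{t - D..t + D}\<close>, whether it is cut off
      on neither, one or both sides.\<close>
    have "{max a (t - D)<..min b (t + D)} \<subseteq> E \<inter> {a<..b}"
      unfolding E_def using t by force
    then have "measure lborel {max a (t - D)<..min b (t + D)} \<le> measure lborel (E \<inter> {a<..b})"
      by (intro measure_mono_fmeasurable fin) auto
    moreover have "D \<le> min b (t + D) - max a (t - D)" using ab assms(2) by auto
    ultimately have "D \<le> p b - p a" using ab assms(2) by (simp add: diff)
    moreover have "p b - p a \<le> d - c" using ab unfolding J_def by auto
    ultimately show False using dc by simp
  qed
  ultimately show ?thesis using p unfolding N_def by (intro bexI[of _ p]) auto
qed

section \<open>Data sets on the line\<close>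

text \<open>The condition involves two coordinates only and is closed in the product topology, so it
  passes from the features to their closure.\<close>

lemma feat_closure_bound:
  assumes "f \<in> feat_closure X" "x \<in> pts X" "y \<in> pts X"
    and "\<And>h. h \<in> feats X \<Longrightarrow> \<bar>h x - h y\<bar> \<le> c"
  shows "\<bar>f x - f y\<bar> \<le> c"
proof -
  let ?T = "product_topology (\<lambda>_. euclideanreal) (pts X)"
  let ?C = "{h \<in> topspace ?T. \<bar>h x - h y\<bar> \<in> {..c}}"
  have "continuous_map ?T euclideanreal (\<lambda>h. \<bar>h x - h y\<bar>)"
    using assms(2,3)
    by (intro continuous_map_real_abs continuous_map_diff continuous_map_product_projection)
  then have "closedin ?T ?C"
    by (rule closedin_continuous_map_preimage) auto
  then have "?T closure_of (topspace ?T \<inter> feats X) \<subseteq> ?C"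
    using assms(4) by (intro closure_of_minimal) auto
  moreover have "feat_closure X = ?T closure_of (topspace ?T \<inter> feats X)"
    unfolding feat_closure_def by (rule closure_of_restrict)
  ultimately show ?thesis using assms(1) by blast
qed

lemma feats_subset_feat_closure: "feats X \<subseteq> extensional (pts X) \<Longrightarrow> feats X \<subseteq> feat_closure X"
  unfolding feat_closure_def by (rule closure_of_subset) (simp add: PiE_def)

lemma feat_closure_extensional: "feat_closure X \<subseteq> extensional (pts X)"
  unfolding feat_closure_def
  using closure_of_subset_topspace[of "product_topology (\<lambda>_. euclideanreal) (pts X)"]
  by (fastforce simp: PiE_def)

text \<open>McShane's extension: the infimum over \<open>S\<close> of the cones
  \<open>f y + \<bar>x - y\<bar>\<close>.\<close>

lemma Lip1_extension:
  assumes "\<And>x y. x \<in> S \<Longrightarrow> y \<in> S \<Longrightarrow> \<bar>f x - f y\<bar> \<le> \<bar>x - y\<bar>"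
  shows "\<exists>p\<in>Lip1. \<forall>x\<in>S. p x = f x"
proof (cases "S = {}")
  case True
  then show ?thesis by (auto simp: Lip1_iff intro!: bexI[of _ "\<lambda>_. 0"])
next
  case False
  then obtain z where z: "z \<in> S" by blast
  define p where "p x = (INF y\<in>S. f y + \<bar>x - y\<bar>)" for x
  have lb: "f z - \<bar>x - z\<bar> \<le> f y + \<bar>x - y\<bar>" if "y \<in> S" for x y
    using assms[OF z that] by linarith
  then have bdd: "bdd_below ((\<lambda>y. f y + \<bar>x - y\<bar>) ` S)" for x
    by (auto simp: bdd_below_def)
  have le: "p x - \<bar>x - x'\<bar> \<le> p x'" for x x'
    unfolding p_def[of x']
  proof (rule cINF_greatest[OF False])
    fix y assume "y \<in> S"
    then have "p x \<le> f y + \<bar>x - y\<bar>" unfolding p_def by (rule cINF_lower[OF bdd])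
    then show "p x - \<bar>x - x'\<bar> \<le> f y + \<bar>x' - y\<bar>" by linarith
  qed
  have "p \<in> Lip1"
    unfolding Lip1_iff
  proof (intro allI)
    fix x y show "\<bar>p x - p y\<bar> \<le> \<bar>x - y\<bar>" using le[of x y] le[of y x] by linarith
  qed
  moreover have "p x = f x" if "x \<in> S" for x
  proof (rule antisym)
    show "p x \<le> f x" using cINF_lower[OF bdd[of x] that] unfolding p_def by simp
    show "f x \<le> p x"
      unfolding p_def
    proof (rule cINF_greatest[OF False])
      fix y assume "y \<in> S"
      then show "f x \<le> f y + \<bar>x - y\<bar>" using assms[OF that, of y] by linarith
    qed
  qed
  ultimately show ?thesis by blast
qed

section \<open>The support of a law on the line and the data set that it carries\<close>

definition dist_support :: "real measure \<Rightarrow> real set" where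
  "dist_support \<mu> = {x. \<forall>r>0. 0 < measure \<mu> (ball x r)}"

text \<open>Full support forces the points to be the support of the law, and closedness of the
  support gives completeness. With all 1-Lipschitz functions as features, the feature distance is
  the usual one and composition with \<open>Lip1\<close> stays inside.\<close>

definition line_data_set :: "real measure \<Rightarrow> real data_set" where
  "line_data_set \<mu> =
     \<lparr>pts = dist_support \<mu>, feats = (\<lambda>p. restrict p (dist_support \<mu>)) ` Lip1,
      law = restrict_space \<mu> (dist_support \<mu>)\<rparr>"

lemma line_data_set_sel [simp]:
  "pts (line_data_set \<mu>) = dist_support \<mu>"
  "feats (line_data_set \<mu>) = (\<lambda>p. restrict p (dist_support \<mu>)) ` Lip1"
  "law (line_data_set \<mu>) = restrict_space \<mu> (dist_support \<mu>)"
  by (simp_all add: line_data_set_def)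

context real_distribution
begin

text \<open>By Lindelof's theorem the union of all open null sets is a countable union of such sets,
  hence null; it is the complement of the support.\<close>

lemma null_open_iff: "open U \<Longrightarrow> prob U = 0 \<longleftrightarrow> U \<inter> dist_support M = {}"
proof -
  have Un: "\<Union>{U. open U \<and> prob U = 0} = - dist_support M"
  proof (intro equalityI subsetI)
    fix x assume "x \<in> \<Union>{U. open U \<and> prob U = 0}"
    then obtain U r where U: "x \<in> U" "prob U = 0" "open U" "0 < r" "ball x r \<subseteq> U"
      using open_contains_ball by auto blast
    then have "prob (ball x r) \<le> 0" using finite_measure_mono[of "ball x r" U] by simp
    then show "x \<in> - dist_support M" using U(4) unfolding dist_support_def by (auto simp: not_less)
  next
    fix x assume "x \<in> - dist_support M"
    then obtain r where "0 < r" "prob (ball x r) = 0"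
      unfolding dist_support_def by (auto simp: zero_less_measure_iff)
    then show "x \<in> \<Union>{U. open U \<and> prob U = 0}" by (auto intro!: exI[of _ "ball x r"])
  qed
  obtain F where F: "F \<subseteq> {U. open U \<and> prob U = 0}" "countable F" "\<Union>F = - dist_support M"
    using Lindelof[of "{U. open U \<and> prob U = 0}"] unfolding Un by auto
  have "(\<Union>U\<in>F. U) \<in> null_sets M"
    using F(1,2) by (intro null_sets_UN') (auto simp: null_sets_def emeasure_eq_measure)
  then have null: "prob (- dist_support M) = 0"
    using F(3) by (simp add: measure_eq_0_null_sets)
  assume "open U"
  show ?thesis
  proof
    assume "prob U = 0"
    then have "U \<subseteq> - dist_support M" using \<open>open U\<close> unfolding Un[symmetric] by blast
    then show "U \<inter> dist_support M = {}" by blast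
  next
    assume "U \<inter> dist_support M = {}"
    moreover have "- dist_support M \<in> sets M"
      using F Un open_Union[of "{U. open U \<and> prob U = 0}"] by auto
    ultimately have "prob U \<le> prob (- dist_support M)" by (intro finite_measure_mono) auto
    then show "prob U = 0" using null measure_nonneg[of M U] by linarith
  qed
qed

lemma closed_dist_support: "closed (dist_support M)"
proof -
  have "open (- dist_support M)"
    unfolding open_contains_ball
  proof
    fix x assume "x \<in> - dist_support M"
    then obtain r where "0 < r" "prob (ball x r) = 0"
      unfolding dist_support_def by (auto simp: zero_less_measure_iff)
    then show "\<exists>e>0. ball x e \<subseteq> - dist_support M"
      using null_open_iff[of "ball x r"] by auto
  qed
  then show ?thesis by (simp add: closed_def)
qed

lemma prob_dist_support: "prob (dist_support M) = 1"
proof -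
  have "prob (- dist_support M) = 0"
    using null_open_iff[of "- dist_support M"] closed_dist_support by (simp add: open_Compl)
  then show ?thesis
    using prob_compl[of "dist_support M"] closed_dist_support
    by (simp add: Compl_eq_Diff_UNIV borel_closed)
qed

lemma sets_dist_support [measurable, simp]: "dist_support M \<in> sets borel"
  by (rule borel_closed[OF closed_dist_support])

lemma AE_dist_support: "AE x in M. x \<in> dist_support M"
  using prob_dist_support by (subst prob_Collect_eq_1[symmetric]) auto

lemma dist_support_nonempty: "dist_support M \<noteq> {}"
  using prob_dist_support by auto

text \<open>A pointwise limit of features is 1-Lipschitz on the support and extends to the whole
  line. Box distances between such data sets thus concern \<open>Lip1\<close> alone.\<close>

lemma line_feat_closure: "feat_closure (line_data_set M) = feats (line_data_set M)"
proof
  show "feats (line_data_set M) \<subseteq> feat_closure (line_data_set M)"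
    by (rule feats_subset_feat_closure) auto
  show "feat_closure (line_data_set M) \<subseteq> feats (line_data_set M)"
  proof
    fix f assume f: "f \<in> feat_closure (line_data_set M)"
    have "\<bar>f x - f y\<bar> \<le> \<bar>x - y\<bar>" if "x \<in> dist_support M" "y \<in> dist_support M" for x y
      using that by (intro feat_closure_bound[OF f]) (auto simp: Lip1_iff)
    then obtain p where "p \<in> Lip1" "\<forall>x\<in>dist_support M. p x = f x"
      using Lip1_extension by blast
    moreover have "f \<in> extensional (dist_support M)"
      using f feat_closure_extensional[of "line_data_set M"] by auto
    ultimately have "f = restrict p (dist_support M)"
      by (auto simp: fun_eq_iff extensional_def)
    with \<open>p \<in> Lip1\<close> show "f \<in> feats (line_data_set M)" by auto
  qed
qed

lemma line_bdd_above:
  assumes "x \<in> dist_support M" "y \<in> dist_support M"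
  shows "bdd_above ((\<lambda>f. \<bar>f x - f y\<bar>) ` feats (line_data_set M))"
  using assms by (auto simp: bdd_above_def Lip1_iff intro!: exI[of _ "\<bar>x - y\<bar>"])

lemma line_feat_dist:
  "feat_dist (line_data_set M) x y = (if x \<in> dist_support M \<and> y \<in> dist_support M then dist x y else 0)"
proof (cases "x \<in> dist_support M \<and> y \<in> dist_support M")
  case True
  let ?F = "feats (line_data_set M)"
  have "(SUP f\<in>?F. \<bar>f x - f y\<bar>) \<le> \<bar>x - y\<bar>"
    using True ident_Lip1 by (intro cSUP_least) (auto simp: Lip1_iff)
  moreover have "\<bar>x - y\<bar> \<le> (SUP f\<in>?F. \<bar>f x - f y\<bar>)"
    using True cSUP_upper[OF _ line_bdd_above[of x y], of "restrict (\<lambda>x. x) (dist_support M)"]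
      ident_Lip1 by auto
  ultimately show ?thesis using True by (simp add: feat_dist_def dist_real_def)
qed (auto simp: feat_dist_def)

lemma line_Metric_space: "Metric_space (dist_support M) (feat_dist (line_data_set M))"
  by unfold_locales (auto simp: line_feat_dist dist_commute dist_triangle)

lemma line_feat_topology: "feat_topology (line_data_set M) = top_of_set (dist_support M)"
proof -
  interpret L: Metric_space "dist_support M" "feat_dist (line_data_set M)"
    by (rule line_Metric_space)
  have "openin L.mtopology U \<longleftrightarrow> openin (top_of_set (dist_support M)) U" for U
  proof -
    have "L.mball x r \<subseteq> U \<longleftrightarrow> (\<forall>y\<in>dist_support M. dist y x < r \<longrightarrow> y \<in> U)"
      if "x \<in> dist_support M" for x r
      using that by (auto simp: L.mball_def line_feat_dist dist_commute)
    then show ?thesis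
      unfolding L.openin_mtopology openin_euclidean_subtopology_iff by (meson subsetD)
  qed
  then show ?thesis
    unfolding feat_topology_def by (simp add: topology_eq)
qed

lemma line_law_prob_space: "prob_space (restrict_space M (dist_support M))"
  using prob_dist_support
  by (intro prob_spaceI) (simp add: emeasure_restrict_space space_restrict_space emeasure_eq_measure)

lemma geometric_data_set_line: "geometric_data_set (line_data_set M)"
proof -
  interpret L: Metric_space "dist_support M" "feat_dist (line_data_set M)"
    by (rule line_Metric_space)
  let ?S = "dist_support M"
  have "L.mcomplete"
    unfolding L.mcomplete_def
  proof (intro allI impI)
    fix \<sigma> assume \<sigma>: "L.MCauchy \<sigma>"
    then have \<sigma>S: "\<sigma> n \<in> ?S" for n unfolding L.MCauchy_def by auto
    then have "Cauchy \<sigma>" using \<sigma> unfolding L.MCauchy_def Cauchy_def by (simp add: line_feat_dist)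
    then obtain l where l: "\<sigma> \<longlonglongrightarrow> l" using Cauchy_convergent convergent_def by blast
    then have "l \<in> ?S" using closed_sequentially[OF closed_dist_support] \<sigma>S by blast
    then have "limitin L.mtopology \<sigma> l sequentially"
      using l \<sigma>S unfolding L.limit_metric_sequentially lim_sequentially by (simp add: line_feat_dist)
    then show "\<exists>x. limitin L.mtopology \<sigma> x sequentially" by blast
  qed
  moreover have "separable_space (top_of_set ?S)"
  proof -
    obtain T where "countable T" "T \<subseteq> ?S" "?S \<subseteq> closure T" by (rule separable)
    then show ?thesis
      unfolding separable_space_def
      by (intro exI[of _ T]) (auto simp: closure_of_subtopology Int_absorb1)
  qed
  moreover have "sets (restrict_space M ?S) = sigma_sets ?S {U. openin (top_of_set ?S) U}"
  proof -
    have "sets (restrict_space M ?S) = (\<inter>) ?S ` sigma_sets UNIV {U. open U}"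
      by (simp add: sets_restrict_space borel_def)
    also have "\<dots> = sigma_sets ?S ((\<inter>) ?S ` {U. open U})"
      using sets_dist_support by (intro sigma_sets_Int) (auto simp: borel_def)
    also have "(\<inter>) ?S ` {U. open U} = {U. openin (top_of_set ?S) U}"
      by (auto simp: openin_open)
    finally show ?thesis .
  qed
  moreover have "0 < emeasure (restrict_space M ?S) U" if U: "openin (top_of_set ?S) U" "U \<noteq> {}" for U
  proof -
    obtain V where V: "open V" "U = ?S \<inter> V" using U(1) by (auto simp: openin_open)
    have "prob V \<noteq> 0" using null_open_iff[OF V(1)] V(2) U(2) by auto
    moreover have "emeasure M U = emeasure M V"
      using AE_dist_support V by (intro emeasure_eq_AE) (auto elim!: AE_mp)
    ultimately show ?thesis
      using V(2) by (simp add: emeasure_restrict_space emeasure_eq_measure zero_less_measure_iff)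
  qed
  ultimately show ?thesis
    unfolding geometric_data_set_def line_feat_topology
    using line_bdd_above line_Metric_space line_law_prob_space ident_Lip1
    by (auto simp: space_restrict_space)
qed

text \<open>Every feature is a 1-Lipschitz function of the identity, so the identity alone is a net
  for every \<epsilon>.\<close>

lemma L_compact_line: "L_compact Lip1 (line_data_set M)"
proof -
  let ?S = "dist_support M"
  let ?id = "restrict (\<lambda>x. x) ?S"
  have "compose ?S p (restrict q ?S) = restrict (p \<circ> q) ?S" for p q :: "real \<Rightarrow> real"
    by (auto simp: compose_def fun_eq_iff)
  moreover have "p \<circ> q \<in> Lip1" if "p \<in> Lip1" "q \<in> Lip1" for p q
    using that unfolding Lip1_iff by (metis comp_apply order_trans)
  ultimately have 1: "comp_feats Lip1 (line_data_set M) (feats (line_data_set M)) \<subseteq> feats (line_data_set M)"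
    by (fastforce simp: comp_feats_def)
  have refl: "ky_fan X f f < \<epsilon>" if "0 < \<epsilon>" for X :: "real data_set" and f \<epsilon>
  proof -
    have "ky_fan X f f \<le> 0" unfolding ky_fan_def by (intro cInf_lower) (auto simp: bdd_below_def)
    then show ?thesis using that by simp
  qed
  have "feats (line_data_set M) \<subseteq> comp_feats Lip1 (line_data_set M) {?id}"
  proof
    fix f assume "f \<in> feats (line_data_set M)"
    then obtain p where "p \<in> Lip1" "f = restrict p ?S" by auto
    moreover have "restrict p ?S = compose ?S p ?id" by (auto simp: compose_def fun_eq_iff)
    ultimately show "f \<in> comp_feats Lip1 (line_data_set M) {?id}"
      unfolding comp_feats_def by (intro image_eqI[of _ _ "(p, ?id)"]) simp_all
  qed
  then have "feats (line_data_set M) \<subseteq> nbhd (comp_feats Lip1 (line_data_set M) {?id}) \<epsilon> (ky_fan (line_data_set M))"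
    if "0 < \<epsilon>" for \<epsilon>
    using refl[OF that] unfolding nbhd_def by blast
  then have Cov: "Cov (line_data_set M) (feats (line_data_set M)) \<epsilon> Lip1 \<le> enat (card {?id})" if "0 < \<epsilon>" for \<epsilon>
    unfolding Cov_def using that ident_Lip1 by (intro INF_lower) auto
  then show ?thesis
    unfolding L_compact_def line_feat_closure
  proof (intro conjI 1 allI impI)
    fix \<epsilon> :: real assume "0 < \<epsilon>"
    from Cov[OF this] show "Cov (line_data_set M) (feats (line_data_set M)) \<epsilon> Lip1 < \<infinity>"
      by (rule order.strict_trans1) simp
  qed
qed

lemma line_in_L_data_sets: "line_data_set M \<in> L_data_sets Lip1"
  by (simp add: L_data_sets_def geometric_data_set_line L_compact_line)

text \<open>The identity is a feature, and since the complement of the support is null it pushes the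
  restricted law to \<open>M\<close> itself.\<close>

lemma part_diam_le_obs_diam_line: "part_diam M (1 - \<kappa>) \<le> obs_diam (line_data_set M) \<kappa>"
proof -
  let ?S = "dist_support M"
  let ?id = "restrict (\<lambda>x. x) ?S"
  have "distr (restrict_space M ?S) borel ?id = M"
  proof (rule measure_eqI)
    fix A assume "A \<in> sets (distr (restrict_space M ?S) borel ?id)"
    then have A: "A \<in> sets borel" by simp
    have "?id \<in> borel_measurable (restrict_space M ?S)"
      by (rule measurable_cong[THEN iffD1, of _ "\<lambda>x. x"])
        (auto simp: space_restrict_space intro!: measurable_restrict_space1)
    moreover have "?id -` A \<inter> space (restrict_space M ?S) = A \<inter> ?S"
      by (auto simp: space_restrict_space)
    moreover have "emeasure M (A \<inter> ?S) = emeasure M A"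
      using AE_dist_support A by (intro emeasure_eq_AE) (auto elim!: AE_mp)
    ultimately show "emeasure (distr (restrict_space M ?S) borel ?id) A = emeasure M A"
      using A by (simp add: emeasure_distr emeasure_restrict_space)
  qed simp
  then show ?thesis
    unfolding obs_diam_def using ident_Lip1
    by (intro SUP_upper2[of ?id]) auto
qed

end

section \<open>Features, domination and box distance\<close>

lemma geometric_data_setD:
  assumes "geometric_data_set X"
  shows "feats X \<noteq> {}" "feats X \<subseteq> extensional (pts X)"
    "\<And>x y. x \<in> pts X \<Longrightarrow> y \<in> pts X \<Longrightarrow> bdd_above ((\<lambda>f. \<bar>f x - f y\<bar>) ` feats X)"
    "Metric_space (pts X) (feat_dist X)" "space (law X) = pts X"
    "sets (law X) = sigma_sets (pts X) {U. openin (feat_topology X) U}"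
    "prob_space (law X)" "\<And>U. openin (feat_topology X) U \<Longrightarrow> U \<noteq> {} \<Longrightarrow> emeasure (law X) U > 0"
  using assms unfolding geometric_data_set_def by simp_all

lemma feat_closure_lipschitz:
  assumes "geometric_data_set X" "f \<in> feat_closure X" "x \<in> pts X" "y \<in> pts X"
  shows "\<bar>f x - f y\<bar> \<le> feat_dist X x y"
proof (rule feat_closure_bound[OF assms(2-4)])
  fix h assume "h \<in> feats X"
  then show "\<bar>h x - h y\<bar> \<le> feat_dist X x y"
    unfolding feat_dist_def
    using cSUP_upper[OF _ geometric_data_setD(3)[OF assms(1,3,4)], of h] assms(3,4) by simp
qed

lemma openin_feat_vimage:
  assumes "geometric_data_set X" "f \<in> feat_closure X" "open U"
  shows "openin (feat_topology X) (f -` U \<inter> pts X)"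
proof -
  interpret Metric_space "pts X" "feat_dist X" by (rule geometric_data_setD(4)[OF assms(1)])
  show ?thesis
    unfolding feat_topology_def openin_mtopology
  proof (intro conjI allI impI)
    fix x assume x: "x \<in> f -` U \<inter> pts X"
    then obtain r where r: "0 < r" "ball (f x) r \<subseteq> U"
      using openE[OF assms(3), of "f x"] by auto
    have "mball x r \<subseteq> f -` U \<inter> pts X"
    proof
      fix y assume y: "y \<in> mball x r"
      then have "dist (f x) (f y) < r"
        using feat_closure_lipschitz[OF assms(1,2), of x y] by (auto simp: dist_real_def)
      then show "y \<in> f -` U \<inter> pts X" using r(2) y by auto
    qed
    with r(1) show "\<exists>r>0. mball x r \<subseteq> f -` U \<inter> pts X" by blast
  qed auto
qed

lemma feat_closure_measurable:
  assumes "geometric_data_set X" "f \<in> feat_closure X"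
  shows "f \<in> borel_measurable (law X)"
proof (rule borel_measurableI)
  fix U :: "real set" assume "open U"
  then show "f -` U \<inter> space (law X) \<in> sets (law X)"
    unfolding geometric_data_setD(5,6)[OF assms(1)] using openin_feat_vimage[OF assms] by auto
qed

lemma real_distribution_feat:
  assumes "geometric_data_set X" "f \<in> feat_closure X"
  shows "real_distribution (distr (law X) borel f)"
  using prob_space.real_distribution_distr[OF geometric_data_setD(7)] feat_closure_measurable assms
  by blast

text \<open>\<open>f\<close> is continuous and the law has full support, so preimages of balls
  around \<open>f x\<close> have positive mass. The conclusion holds at every point, not just almost
  everywhere, as a map between point sets requires.\<close>

lemma feat_in_dist_support:
  assumes "geometric_data_set X" "f \<in> feat_closure X" "x \<in> pts X"
  shows "f x \<in> dist_support (distr (law X) borel f)"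
proof -
  interpret prob_space "law X" by (rule geometric_data_setD(7)[OF assms(1)])
  have "0 < measure (distr (law X) borel f) (ball (f x) r)" if "0 < r" for r
  proof -
    have "x \<in> f -` ball (f x) r \<inter> pts X" using that assms(3) by simp
    then have "f -` ball (f x) r \<inter> pts X \<noteq> {}" by blast
    then have "0 < emeasure (law X) (f -` ball (f x) r \<inter> pts X)"
      using openin_feat_vimage[OF assms(1,2), of "ball (f x) r"]
      by (intro geometric_data_setD(8)[OF assms(1)]) simp_all
    then show ?thesis
      using feat_closure_measurable[OF assms(1,2)] geometric_data_setD(5)[OF assms(1)]
      by (simp add: measure_distr emeasure_eq_measure)
  qed
  then show ?thesis unfolding dist_support_def by blast
qed

text \<open>\<open>f\<close> itself is the dominating map: pulling back a 1-Lipschitz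
  \<open>p\<close> gives \<open>p\<close> composed with \<open>f\<close>, which
  \<open>L_compact\<close> keeps in the closure.\<close>

lemma line_data_set_dominated:
  assumes X: "geometric_data_set X" and L: "L_compact Lip1 X" and f: "f \<in> feat_closure X"
  shows "line_data_set (distr (law X) borel f) \<preceq>\<^sub>D X"
proof -
  let ?\<nu> = "distr (law X) borel f"
  let ?S = "dist_support ?\<nu>"
  interpret real_distribution ?\<nu> by (rule real_distribution_feat[OF X f])
  note [measurable] = feat_closure_measurable[OF X f]
  have fS: "f x \<in> ?S" if "x \<in> pts X" for x using feat_in_dist_support[OF X f that] .
  have meas: "f \<in> law X \<rightarrow>\<^sub>M restrict_space ?\<nu> ?S"
    using fS geometric_data_setD(5)[OF X] by (intro measurable_restrict_space2) auto
  have "distr (law X) (restrict_space ?\<nu> ?S) f = restrict_space ?\<nu> ?S"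
  proof (rule measure_eqI)
    fix A assume "A \<in> sets (distr (law X) (restrict_space ?\<nu> ?S) f)"
    then have A: "A \<subseteq> ?S" "A \<in> sets borel" "A \<in> sets (restrict_space ?\<nu> ?S)"
      by (simp_all add: sets_restrict_space_iff)
    then show "emeasure (distr (law X) (restrict_space ?\<nu> ?S) f) A = emeasure (restrict_space ?\<nu> ?S) A"
      by (simp add: emeasure_restrict_space emeasure_distr[OF meas] emeasure_distr)
  qed simp
  moreover have "compose (pts X) g f \<in> feat_closure X" if g: "g \<in> feats (line_data_set ?\<nu>)" for g
  proof -
    obtain p where p: "p \<in> Lip1" "g = restrict p ?S" using g unfolding line_data_set_sel by blast
    have "compose (pts X) g f = compose (pts X) p f"
      unfolding p(2) by (rule ext) (simp add: compose_def fS)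
    moreover have "compose (pts X) p f \<in> comp_feats Lip1 X (feat_closure X)"
      unfolding comp_feats_def using p(1) f by (intro image_eqI[of _ _ "(p, f)"] SigmaI) (simp_all only: prod.case)
    ultimately show ?thesis using L unfolding L_compact_def by (metis subsetD)
  qed
  then have "(\<lambda>g. compose (pts X) g f) ` feats (line_data_set ?\<nu>) \<subseteq> feat_closure X" by blast
  ultimately show ?thesis
    unfolding dominated_by_def line_data_set_sel(3) using meas by blast
qed

lemma L_pyramidD:
  assumes "L_pyramid \<L> P"
  shows "P \<subseteq> L_data_sets \<L>" "\<And>X Y. X \<in> L_data_sets \<L> \<Longrightarrow> Y \<in> P \<Longrightarrow> X \<preceq>\<^sub>D Y \<Longrightarrow> X \<in> P"
  using assms unfolding L_pyramid_def iso_classes_in_def by blast+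

text \<open>Box distance compares closures of feature sets, while \<open>obs_diam\<close> takes its
  supremum over the features. Here a function in the closure is traded for a member of the pyramid
  in which the identity, a genuine feature, has the same law.\<close>

lemma L_pyramid_line_data_set:
  assumes "L_pyramid Lip1 P" "X \<in> P" "f \<in> feat_closure X"
  shows "line_data_set (distr (law X) borel f) \<in> P"
proof -
  have X: "geometric_data_set X" "L_compact Lip1 X"
    using L_pyramidD(1)[OF assms(1)] assms(2) unfolding L_data_sets_def by auto
  show ?thesis
    by (rule L_pyramidD(2)[OF assms(1) real_distribution.line_in_L_data_sets assms(2)
          line_data_set_dominated[OF X assms(3)]])
      (rule real_distribution_feat[OF X(1) assms(3)])
qed

lemma part_diam_le_ObsDiam_line:
  assumes "real_distribution \<mu>" "line_data_set \<mu> \<in> P"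
  shows "part_diam \<mu> (1 - \<kappa>) \<le> ObsDiam P \<kappa>"
  unfolding ObsDiam_def
  by (rule order_trans[OF real_distribution.part_diam_le_obs_diam_line[OF assms(1)]
        SUP_upper[OF assms(2), where f = "\<lambda>X. obs_diam X \<kappa>"]])

section \<open>Transfer of partial diameters, and bounds on box distance, through couplings\<close>

text \<open>On a nearly optimal coupling, \<open>f\<close> of the first coordinate and a suitable
  \<open>g\<close> of the second are random variables on one space, \<delta>-close on a set
  \<open>S\<close> of mass above 1 - \<delta>. So \<open>part_diam_perturb\<close> applies.\<close>

lemma box_dist_part_diam:
  assumes X: "geometric_data_set X" and Y: "geometric_data_set Y" and f: "f \<in> feat_closure X"
    and box: "box_dist X Y < ennreal \<delta>" and "\<delta> \<le> 1" "0 < \<alpha>"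
  shows "\<exists>g\<in>feat_closure Y. part_diam (distr (law X) borel f) \<alpha>
           \<le> part_diam (distr (law Y) borel g) (\<alpha> + \<delta>) + ennreal (2 * \<delta>)"
proof -
  have "0 < \<delta>" using box by (metis ennreal_eq_0_iff not_le not_less_zero)
  obtain \<pi> S where \<pi>: "\<pi> \<in> couplings X Y" and
    S: "ennreal (1 - measure \<pi> S) < ennreal \<delta>"
      "2 * hausdorff_dist (unif_dist S) ((\<lambda>f. f \<circ> fst) ` feat_closure X)
         ((\<lambda>g. g \<circ> snd) ` feat_closure Y) < ennreal \<delta>" (is "2 * ?h < _")
    using box unfolding box_dist_def INF_less_iff by auto
  have \<pi>: "sets \<pi> = sets (law X \<Otimes>\<^sub>M law Y)" "distr \<pi> (law X) fst = law X" "distr \<pi> (law Y) snd = law Y"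
    using \<pi> unfolding couplings_def by auto
  note [measurable_cong] = \<pi>(1)
  have sp: "space \<pi> = pts X \<times> pts Y"
    using sets_eq_imp_space_eq[OF \<pi>(1)] geometric_data_setD(5)[OF X] geometric_data_setD(5)[OF Y]
    by (simp add: space_pair_measure)
  interpret prob_space \<pi>
  proof (rule prob_space_distrD)
    show "fst \<in> \<pi> \<rightarrow>\<^sub>M law X" by measurable
    show "prob_space (distr \<pi> (law X) fst)" unfolding \<pi>(2) by (rule geometric_data_setD(7)[OF X])
  qed
  \<comment> \<open>The factor 2 in the box distance is given away.\<close>
  have "?h \<le> 2 * ?h" by (simp add: mult_2)
  then have "?h < ennreal \<delta>" using S(2) by (rule le_less_trans)
  then obtain \<epsilon> where \<epsilon>: "\<epsilon> < ennreal \<delta>"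
    "(\<lambda>f. f \<circ> fst) ` feat_closure X \<subseteq> nbhd ((\<lambda>g. g \<circ> snd) ` feat_closure Y) \<epsilon> (unif_dist S)"
    unfolding hausdorff_dist_def Inf_less_iff by auto
  then obtain g where g: "g \<in> feat_closure Y" "unif_dist S (f \<circ> fst) (g \<circ> snd) < \<epsilon>"
    using f unfolding nbhd_def by blast
  have close: "\<bar>f (fst s) - g (snd s)\<bar> \<le> \<delta>" if "s \<in> S" for s
  proof -
    have "ennreal \<bar>(f \<circ> fst) s - (g \<circ> snd) s\<bar> \<le> unif_dist S (f \<circ> fst) (g \<circ> snd)"
      unfolding unif_dist_def using that by (rule SUP_upper)
    also have "\<dots> < ennreal \<delta>" using g(2) \<epsilon>(1) by (rule less_trans)
    finally show ?thesis by (simp add: ennreal_less_iff)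
  qed
  have mS: "1 - \<delta> < measure \<pi> S" using S(1) \<open>0 < \<delta>\<close> by (simp add: ennreal_less_iff)
  \<comment> \<open>Measurability of \<open>S\<close> is read off from the default value: a set
    outside the \<sigma>-algebra would have measure 0.\<close>
  then have "measure \<pi> S \<noteq> 0" using \<open>\<delta> \<le> 1\<close> by simp
  then have SM: "S \<in> sets \<pi>" using measure_notin_sets by blast
  note mf = feat_closure_measurable[OF X f] and mg = feat_closure_measurable[OF Y g(1)]
  have fm[measurable]: "fst \<in> \<pi> \<rightarrow>\<^sub>M law X" "snd \<in> \<pi> \<rightarrow>\<^sub>M law Y" by measurable
  have [measurable]: "(\<lambda>z. f (fst z)) \<in> borel_measurable \<pi>" "(\<lambda>z. g (snd z)) \<in> borel_measurable \<pi>"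
    using measurable_compose[OF fm(1) mf] measurable_compose[OF fm(2) mg] by auto
  have "measure \<pi> {z \<in> space \<pi>. \<delta> < \<bar>g (snd z) - f (fst z)\<bar>} \<le> measure \<pi> (space \<pi> - S)"
  proof (rule finite_measure_mono)
    show "{z \<in> space \<pi>. \<delta> < \<bar>g (snd z) - f (fst z)\<bar>} \<subseteq> space \<pi> - S"
    proof
      fix z assume z: "z \<in> {z \<in> space \<pi>. \<delta> < \<bar>g (snd z) - f (fst z)\<bar>}"
      have "z \<notin> S"
      proof
        assume "z \<in> S"
        from close[OF this] show False using z by (simp add: abs_minus_commute)
      qed
      with z show "z \<in> space \<pi> - S" by simp
    qed
  qed (use SM in simp)
  also have "\<dots> \<le> \<delta>" using prob_compl[OF SM] mS by simp
  finally have *: "measure \<pi> {z \<in> space \<pi>. \<delta> < \<bar>g (snd z) - f (fst z)\<bar>} \<le> \<delta>" .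
  have "part_diam (distr \<pi> borel (\<lambda>z. f (fst z))) \<alpha>
      \<le> part_diam (distr \<pi> borel (\<lambda>z. g (snd z))) (\<alpha> + \<delta>) + ennreal (2 * \<delta>)"
    by (rule part_diam_perturb[OF prob_space_axioms _ _ less_imp_le[OF \<open>0 < \<delta>\<close>] \<open>0 < \<alpha>\<close> *]) measurable
  moreover have "distr \<pi> borel (\<lambda>z. f (fst z)) = distr (law X) borel f"
    using distr_distr[OF mf fm(1)] unfolding \<pi>(2) o_def ..
  moreover have "distr \<pi> borel (\<lambda>z. g (snd z)) = distr (law Y) borel g"
    using distr_distr[OF mg fm(2)] unfolding \<pi>(3) o_def ..
  ultimately show ?thesis by (intro bexI[OF _ g(1)]) simp
qed

text \<open>A variable with law \<mu> lies in the support only almost surely; redefining it on a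
  null set by a fixed point \<open>s\<close> turns it into a map to the points of the data
  set.\<close>

lemma ex_version_in_dist_support:
  assumes "prob_space \<Omega>" and [measurable]: "Y \<in> borel_measurable \<Omega>"
    and dY: "distr \<Omega> borel Y = \<mu>"
  shows "\<exists>y \<in> \<Omega> \<rightarrow>\<^sub>M restrict_space \<mu> (dist_support \<mu>).
    (AE \<omega> in \<Omega>. y \<omega> = Y \<omega>) \<and>
    distr \<Omega> (restrict_space \<mu> (dist_support \<mu>)) y = restrict_space \<mu> (dist_support \<mu>)"
proof -
  interpret prob_space \<Omega> by fact
  interpret \<mu>: real_distribution \<mu> unfolding dY[symmetric] by simp
  let ?S = "dist_support \<mu>"
  obtain s where s: "s \<in> ?S" using \<mu>.dist_support_nonempty by blast
  define y where "y \<omega> = (if Y \<omega> \<in> ?S then Y \<omega> else s)" for \<omega>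
  have [measurable]: "y \<in> borel_measurable \<Omega>" unfolding y_def by measurable
  have y: "y \<in> \<Omega> \<rightarrow>\<^sub>M restrict_space \<mu> ?S"
  proof (rule measurable_restrict_space2)
    show "y \<in> space \<Omega> \<rightarrow> ?S" using s by (auto simp: y_def)
    show "y \<in> \<Omega> \<rightarrow>\<^sub>M \<mu>" by (simp add: measurable_cong_sets[OF refl \<mu>.events_eq_borel])
  qed
  have "AE x in distr \<Omega> borel Y. x \<in> ?S" unfolding dY by (rule \<mu>.AE_dist_support)
  then have "AE \<omega> in \<Omega>. Y \<omega> \<in> ?S" by (subst (asm) AE_distr_iff) auto
  then have ae: "AE \<omega> in \<Omega>. y \<omega> = Y \<omega>" by eventually_elim (simp add: y_def)
  have dy: "distr \<Omega> borel y = \<mu>" unfolding dY[symmetric] using ae by (intro distr_cong_AE) auto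
  have "distr \<Omega> (restrict_space \<mu> ?S) y = restrict_space \<mu> ?S"
  proof (rule measure_eqI)
    fix A assume "A \<in> sets (distr \<Omega> (restrict_space \<mu> ?S) y)"
    then have A: "A \<subseteq> ?S" "A \<in> sets borel" "A \<in> sets (restrict_space \<mu> ?S)"
      by (simp_all add: sets_restrict_space_iff)
    have "emeasure (restrict_space \<mu> ?S) A = emeasure (distr \<Omega> borel y) A"
      using A by (simp add: emeasure_restrict_space dy)
    also have "\<dots> = emeasure (distr \<Omega> (restrict_space \<mu> ?S) y) A"
      using A y by (simp add: emeasure_distr)
    finally show "emeasure (distr \<Omega> (restrict_space \<mu> ?S) y) A = emeasure (restrict_space \<mu> ?S) A" ..
  qed simp
  with y ae show ?thesis by blast
qed

text \<open>The restrictions of one and the same \<open>p\<close> are matched with each other; as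
  \<open>p\<close> is 1-Lipschitz they differ by at most \<delta> on \<open>S\<close>. The bound
  needs \<epsilon> > \<delta> because neighbourhoods are open.\<close>

lemma hausdorff_dist_line_le:
  assumes "real_distribution \<mu>" "real_distribution \<nu>" "0 \<le> \<delta>" "\<delta> < \<epsilon>"
    and "\<And>s. s \<in> S \<Longrightarrow> fst s \<in> dist_support \<mu> \<and> snd s \<in> dist_support \<nu> \<and> \<bar>fst s - snd s\<bar> \<le> \<delta>"
  shows "hausdorff_dist (unif_dist S) ((\<lambda>f. f \<circ> fst) ` feat_closure (line_data_set \<mu>))
           ((\<lambda>g. g \<circ> snd) ` feat_closure (line_data_set \<nu>)) \<le> ennreal \<epsilon>"
proof -
  let ?f = "\<lambda>p. restrict p (dist_support \<mu>) \<circ> fst" and ?g = "\<lambda>p. restrict p (dist_support \<nu>) \<circ> snd"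
  have le: "unif_dist S (?f p) (?g p) < ennreal \<epsilon>" "unif_dist S (?g p) (?f p) < ennreal \<epsilon>"
    if "p \<in> Lip1" for p
  proof -
    have "\<bar>p (fst s) - p (snd s)\<bar> \<le> \<delta>" if "s \<in> S" for s
      using assms(5)[OF that] \<open>p \<in> Lip1\<close> unfolding Lip1_iff by (meson order_trans)
    then have "unif_dist S (?f p) (?g p) \<le> ennreal \<delta>" "unif_dist S (?g p) (?f p) \<le> ennreal \<delta>"
      unfolding unif_dist_def using assms(5)
      by (auto intro!: SUP_least ennreal_leI simp: abs_minus_commute)
    moreover have "ennreal \<delta> < ennreal \<epsilon>" using assms(3,4) by (simp add: ennreal_less_iff)
    ultimately show "unif_dist S (?f p) (?g p) < ennreal \<epsilon>" "unif_dist S (?g p) (?f p) < ennreal \<epsilon>"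
      by (auto intro: le_less_trans)
  qed
  have "0 < \<epsilon>" using assms(3,4) by simp
  with le show ?thesis
    unfolding hausdorff_dist_def real_distribution.line_feat_closure[OF assms(1)]
      real_distribution.line_feat_closure[OF assms(2)]
    by (intro Inf_lower) (auto simp: nbhd_def)
qed

text \<open>The coupling is the joint law of versions of \<open>Y\<close> and \<open>Z\<close>, and
  \<open>S\<close> is the \<delta>-strip around the diagonal. The constant 4 comes from the
  Hausdorff bound \<open>2 * \<delta>\<close>, taken strictly above \<delta>, and the factor 2 of
  the box distance.\<close>

lemma box_dist_line_le:
  assumes \<Omega>: "prob_space \<Omega>" and Y [measurable]: "Y \<in> borel_measurable \<Omega>"
    and Z [measurable]: "Z \<in> borel_measurable \<Omega>"
    and dY: "distr \<Omega> borel Y = \<mu>" and dZ: "distr \<Omega> borel Z = \<nu>"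
    and "0 < \<delta>" "\<delta> < 1" "measure \<Omega> {\<omega> \<in> space \<Omega>. \<delta> < \<bar>Y \<omega> - Z \<omega>\<bar>} \<le> \<delta>"
  shows "box_dist (line_data_set \<mu>) (line_data_set \<nu>) \<le> ennreal (4 * \<delta>)"
proof -
  interpret prob_space \<Omega> by fact
  interpret \<mu>: real_distribution \<mu> unfolding dY[symmetric] by simp
  interpret \<nu>: real_distribution \<nu> unfolding dZ[symmetric] by simp
  let ?A = "restrict_space \<mu> (dist_support \<mu>)" and ?B = "restrict_space \<nu> (dist_support \<nu>)"
  obtain y where y [measurable]: "y \<in> \<Omega> \<rightarrow>\<^sub>M ?A" and ey: "AE \<omega> in \<Omega>. y \<omega> = Y \<omega>" and dy: "distr \<Omega> ?A y = ?A"
    using ex_version_in_dist_support[OF \<Omega> Y dY] by blast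
  obtain z where z [measurable]: "z \<in> \<Omega> \<rightarrow>\<^sub>M ?B" and ez: "AE \<omega> in \<Omega>. z \<omega> = Z \<omega>" and dz: "distr \<Omega> ?B z = ?B"
    using ex_version_in_dist_support[OF \<Omega> Z dZ] by blast
  define \<pi> where "\<pi> = distr \<Omega> (?A \<Otimes>\<^sub>M ?B) (\<lambda>\<omega>. (y \<omega>, z \<omega>))"
  define S where "S = {s \<in> dist_support \<mu> \<times> dist_support \<nu>. \<bar>fst s - snd s\<bar> \<le> \<delta>}"
  have \<pi>: "\<pi> \<in> couplings (line_data_set \<mu>) (line_data_set \<nu>)"
    unfolding couplings_def \<pi>_def by (simp add: distr_distr o_def dy dz)
  have inA: "(\<lambda>x. x) \<in> borel_measurable ?A" and inB: "(\<lambda>x. x) \<in> borel_measurable ?B"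
    by (simp_all add: measurable_restrict_space1)
  have [measurable]: "fst \<in> borel_measurable (?A \<Otimes>\<^sub>M ?B)" "snd \<in> borel_measurable (?A \<Otimes>\<^sub>M ?B)"
    using measurable_compose[OF measurable_fst inA] measurable_compose[OF measurable_snd inB] by auto
  have spAB: "space (?A \<Otimes>\<^sub>M ?B) = dist_support \<mu> \<times> dist_support \<nu>"
    by (simp add: space_pair_measure space_restrict_space)
  have SM: "S \<in> sets (?A \<Otimes>\<^sub>M ?B)"
    unfolding S_def spAB[symmetric] by measurable
  have [measurable]: "y \<in> borel_measurable \<Omega>" "z \<in> borel_measurable \<Omega>"
    using measurable_compose[OF y inA] measurable_compose[OF z inB] by auto
  have yz: "y \<omega> \<in> dist_support \<mu>" "z \<omega> \<in> dist_support \<nu>" if "\<omega> \<in> space \<Omega>" for \<omega>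
    using measurable_space[OF y that] measurable_space[OF z that] by (auto simp: space_restrict_space)
  have "measure \<pi> S = measure \<Omega> {\<omega> \<in> space \<Omega>. \<bar>y \<omega> - z \<omega>\<bar> \<le> \<delta>}"
    unfolding \<pi>_def using SM
    by (subst measure_distr) (auto simp: S_def yz intro!: arg_cong[where f = prob])
  also have "\<dots> = measure \<Omega> {\<omega> \<in> space \<Omega>. \<bar>Y \<omega> - Z \<omega>\<bar> \<le> \<delta>}"
    using ey ez by (intro finite_measure_eq_AE) (auto elim!: AE_mp)
  also have "\<dots> = 1 - measure \<Omega> {\<omega> \<in> space \<Omega>. \<delta> < \<bar>Y \<omega> - Z \<omega>\<bar>}"
    by (subst prob_compl[symmetric]) (auto intro!: arg_cong[where f = prob])
  finally have mS: "1 - \<delta> \<le> measure \<pi> S" using assms(8) by simp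
  then have "S \<noteq> {}" using assms(7) by auto
  moreover have "closedin (top_of_set (dist_support \<mu> \<times> dist_support \<nu>)) S"
  proof -
    have "closed {s :: real \<times> real. \<bar>fst s - snd s\<bar> \<le> \<delta>}"
      by (intro closed_Collect_le continuous_intros)
    moreover have "S = (dist_support \<mu> \<times> dist_support \<nu>) \<inter> {s. \<bar>fst s - snd s\<bar> \<le> \<delta>}"
      unfolding S_def by auto
    ultimately show ?thesis by (simp add: closedin_closed_Int)
  qed
  ultimately have "(\<pi>, S) \<in> couplings (line_data_set \<mu>) (line_data_set \<nu>) \<times>
      {S. closedin (prod_topology (feat_topology (line_data_set \<mu>)) (feat_topology (line_data_set \<nu>))) S \<and> S \<noteq> {}}"
    using \<pi> by (simp add: \<mu>.line_feat_topology \<nu>.line_feat_topology)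
  then show ?thesis
    unfolding box_dist_def
  proof (rule INF_lower2, clarsimp, intro conjI)
    show "ennreal (1 - measure \<pi> S) \<le> ennreal (4 * \<delta>)"
      using mS assms(6) by (intro ennreal_leI) simp
    have "2 * hausdorff_dist (unif_dist S) ((\<lambda>f. f \<circ> fst) ` feat_closure (line_data_set \<mu>))
           ((\<lambda>g. g \<circ> snd) ` feat_closure (line_data_set \<nu>)) \<le> 2 * ennreal (2 * \<delta>)"
      using assms(6)
      by (intro mult_left_mono hausdorff_dist_line_le[OF \<mu>.real_distribution_axioms \<nu>.real_distribution_axioms, of \<delta>])
        (auto simp: S_def)
    also have "\<dots> = ennreal (4 * \<delta>)"
      using assms(6) by (simp add: ennreal_mult'[symmetric] flip: ennreal_numeral)
    finally show "2 * hausdorff_dist (unif_dist S) ((\<lambda>f. f \<circ> fst) ` feat_closure (line_data_set \<mu>))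
           ((\<lambda>g. g \<circ> snd) ` feat_closure (line_data_set \<nu>)) \<le> ennreal (4 * \<delta>)" .
  qed
qed

section \<open>Convergence of observable diameters\<close>

text \<open>Right continuity yields a reserve \<eta> of mass. The shift of \<kappa> uses \<epsilon>
  of it, and the remaining \<eta> - \<epsilon> pays for the couplings.\<close>

lemma ObsDiam_le_liminf:
  assumes pyr: "\<And>n. L_pyramid Lip1 (\<P>s n)" and conv: "weakly_converges Lip1 \<P>s \<P>"
    and "\<kappa> < 1" "c < ObsDiam \<P> \<kappa>"
  shows "\<exists>\<eta>>0. \<forall>\<epsilon>. 0 < \<epsilon> \<longrightarrow> \<epsilon> < \<eta> \<longrightarrow> c \<le> liminf (\<lambda>n. ObsDiam (\<P>s n) (\<kappa> + \<epsilon>))"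
proof -
  obtain X f where X: "X \<in> \<P>" "f \<in> feats X" "c < part_diam (distr (law X) borel f) (1 - \<kappa>)"
    using assms(4) unfolding ObsDiam_def obs_diam_def less_SUP_iff by blast
  have "\<P> \<subseteq> L_data_sets Lip1"
    using conv unfolding weakly_converges_def iso_classes_in_def by blast
  then have gX: "geometric_data_set X" using X(1) unfolding L_data_sets_def by blast
  have f: "f \<in> feat_closure X"
    using feats_subset_feat_closure[OF geometric_data_setD(2)[OF gX]] X(2) by blast
  interpret \<nu>: real_distribution "distr (law X) borel f" by (rule real_distribution_feat[OF gX f])
  obtain \<eta> where \<eta>: "0 < \<eta>" "\<eta> < 1 - \<kappa>" "c < part_diam (distr (law X) borel f) (1 - \<kappa> - \<eta>)"
    using \<nu>.part_diam_right_cont[of "1 - \<kappa>" c] X(3) assms(3) by auto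
  have lim: "(\<lambda>n. box_dist_set X (\<P>s n)) \<longlonglongrightarrow> 0"
    using conv X(1) unfolding weakly_converges_def by blast
  have "c \<le> liminf (\<lambda>n. ObsDiam (\<P>s n) (\<kappa> + \<epsilon>))" (is "c \<le> ?L") if \<epsilon>: "0 < \<epsilon>" "\<epsilon> < \<eta>" for \<epsilon>
  proof (rule ennreal_le_epsilon)
    fix e :: real assume "0 < e"
    \<comment> \<open>The three bounds serve the diameter error \<open>2 * \<delta>\<close>, the
      mass still available, and the requirement \<open>\<delta> \<le> 1\<close> of
      \<open>box_dist_part_diam\<close>.\<close>
    define \<delta> where "\<delta> = min (min (e / 2) (\<eta> - \<epsilon>)) 1"
    have \<delta>: "0 < \<delta>" "\<delta> \<le> 1" "\<delta> \<le> \<eta> - \<epsilon>" "2 * \<delta> \<le> e"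
      using \<open>0 < e\<close> \<epsilon> unfolding \<delta>_def min_def by auto
    have "eventually (\<lambda>n. box_dist_set X (\<P>s n) < ennreal \<delta>) sequentially"
      using lim \<delta>(1) by (intro order_tendstoD) auto
    then have "eventually (\<lambda>n. c - ennreal e \<le> ObsDiam (\<P>s n) (\<kappa> + \<epsilon>)) sequentially"
    proof eventually_elim
      case (elim n)
      then obtain Y where Y: "Y \<in> \<P>s n" "box_dist X Y < ennreal \<delta>"
        unfolding box_dist_set_def INF_less_iff by blast
      have gY: "geometric_data_set Y" using L_pyramidD(1)[OF pyr] Y(1) unfolding L_data_sets_def by blast
      obtain g where g: "g \<in> feat_closure Y"
        "part_diam (distr (law X) borel f) (1 - \<kappa> - \<eta>)
           \<le> part_diam (distr (law Y) borel g) (1 - \<kappa> - \<eta> + \<delta>) + ennreal (2 * \<delta>)"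
        using box_dist_part_diam[OF gX gY f Y(2) \<delta>(2), of "1 - \<kappa> - \<eta>"] \<eta>(2) by auto
      have "c \<le> part_diam (distr (law X) borel f) (1 - \<kappa> - \<eta>)" using \<eta>(3) by simp
      also note g(2)
      also have "part_diam (distr (law Y) borel g) (1 - \<kappa> - \<eta> + \<delta>) + ennreal (2 * \<delta>)
          \<le> part_diam (distr (law Y) borel g) (1 - (\<kappa> + \<epsilon>)) + ennreal e"
        using \<delta> by (intro add_mono part_diam_mono ennreal_leI) auto
      also have "\<dots> \<le> ObsDiam (\<P>s n) (\<kappa> + \<epsilon>) + ennreal e"
        by (intro add_mono order_refl part_diam_le_ObsDiam_line real_distribution_feat[OF gY g(1)]
              L_pyramid_line_data_set[OF pyr Y(1) g(1)])
      finally show ?case by (simp add: ennreal_minus_le_iff add.commute)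
    qed
    then have "c - ennreal e \<le> ?L" by (rule Liminf_bounded)
    then show "c \<le> ?L + ennreal e" by (simp add: ennreal_minus_le_iff add.commute)
  qed
  with \<eta>(1) show ?thesis by blast
qed

text \<open>Composing a feature with the compression stays in the closure by
  \<open>L_compact\<close>, so the compressed law still belongs to the pyramid. The interval depends
  on \<open>D\<close> and \<kappa> only, which makes a sequence of such laws tight.\<close>

lemma ex_compressed_distribution:
  assumes P: "L_pyramid Lip1 P" and "\<kappa> < 1" "0 \<le> D" "ennreal D < ObsDiam P \<kappa>"
  shows "\<exists>\<sigma>. real_distribution \<sigma> \<and> line_data_set \<sigma> \<in> P \<and> ennreal D \<le> part_diam \<sigma> (1 - \<kappa>) \<and>
           measure \<sigma> {0..2 * D * real (nat \<lfloor>2 / (1 - \<kappa>)\<rfloor>)} = 1"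
proof -
  let ?I = "{0..2 * D * real (nat \<lfloor>2 / (1 - \<kappa>)\<rfloor>)}"
  obtain X f where X: "X \<in> P" "f \<in> feats X" "ennreal D < part_diam (distr (law X) borel f) (1 - \<kappa>)"
    using assms(4) unfolding ObsDiam_def obs_diam_def less_SUP_iff by blast
  have gX: "geometric_data_set X" and LX: "L_compact Lip1 X"
    using L_pyramidD(1)[OF P] X(1) unfolding L_data_sets_def by blast+
  have f: "f \<in> feat_closure X"
    using feats_subset_feat_closure[OF geometric_data_setD(2)[OF gX]] X(2) by blast
  interpret X: prob_space "law X" by (rule geometric_data_setD(7)[OF gX])
  interpret \<nu>: real_distribution "distr (law X) borel f" by (rule real_distribution_feat[OF gX f])
  obtain p where p: "p \<in> Lip1" "range p \<subseteq> ?I"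
      "ennreal D \<le> part_diam (distr (distr (law X) borel f) borel p) (1 - \<kappa>)"
    using \<nu>.ex_Lip1_compression[of "1 - \<kappa>" D] assms(2,3) X(3) by auto
  define h where "h = compose (pts X) p f"
  have "h \<in> comp_feats Lip1 X (feat_closure X)"
    unfolding comp_feats_def h_def using p(1) f by (intro image_eqI[of _ _ "(p, f)"] SigmaI) (simp_all only: prod.case)
  then have h: "h \<in> feat_closure X" using LX unfolding L_compact_def by (metis subsetD)
  have "distr (distr (law X) borel f) borel p = distr (law X) borel (p \<circ> f)"
    by (rule distr_distr[OF Lip1_measurable[OF p(1)] feat_closure_measurable[OF gX f]])
  also have "\<dots> = distr (law X) borel h"
    by (rule distr_cong) (simp_all add: h_def compose_def geometric_data_setD(5)[OF gX])
  finally have dh: "distr (distr (law X) borel f) borel p = distr (law X) borel h" .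
  have "p x \<in> ?I" for x using p(2) by blast
  then have "h -` ?I \<inter> space (law X) = space (law X)"
    by (auto simp: h_def compose_def geometric_data_setD(5)[OF gX])
  then have "measure (distr (law X) borel h) ?I = 1"
    using feat_closure_measurable[OF gX h] by (subst measure_distr) (simp_all add: X.prob_space)
  then show ?thesis
    using p(3) real_distribution_feat[OF gX h] L_pyramid_line_data_set[OF P X(1) h] unfolding dh
    by (intro exI[of _ "distr (law X) borel h"] conjI)
qed

text \<open>Dominated convergence for the indicators of the deviation events.\<close>

lemma (in prob_space) tendsto_prob_deviation:
  fixes Y :: "nat \<Rightarrow> 'a \<Rightarrow> real"
  assumes [measurable]: "\<And>n. Y n \<in> borel_measurable M" "Z \<in> borel_measurable M"
    and lim: "\<And>\<omega>. \<omega> \<in> space M \<Longrightarrow> (\<lambda>n. Y n \<omega>) \<longlonglongrightarrow> Z \<omega>" and "0 < \<delta>"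
  shows "(\<lambda>n. prob {\<omega> \<in> space M. \<delta> < \<bar>Z \<omega> - Y n \<omega>\<bar>}) \<longlonglongrightarrow> 0"
proof -
  let ?A = "\<lambda>n. {\<omega> \<in> space M. \<delta> < \<bar>Z \<omega> - Y n \<omega>\<bar>}"
  have "(\<lambda>n. integral\<^sup>L M (indicator (?A n) :: 'a \<Rightarrow> real)) \<longlonglongrightarrow> integral\<^sup>L M (\<lambda>_. 0 :: real)"
  proof (rule integral_dominated_convergence[where w = "\<lambda>_. 1"])
    show "AE \<omega> in M. (\<lambda>n. indicator (?A n) \<omega> :: real) \<longlonglongrightarrow> 0"
    proof (rule AE_I2)
      fix \<omega> assume "\<omega> \<in> space M"
      then have "eventually (\<lambda>n. dist (Y n \<omega>) (Z \<omega>) < \<delta>) sequentially"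
        using tendstoD[OF lim \<open>0 < \<delta>\<close>] by blast
      then have "eventually (\<lambda>n. indicator (?A n) \<omega> = (0 :: real)) sequentially"
        by eventually_elim (auto simp: dist_real_def indicator_def abs_minus_commute)
      then show "(\<lambda>n. indicator (?A n) \<omega> :: real) \<longlonglongrightarrow> 0" by (rule tendsto_eventually)
    qed
  qed (auto simp: indicator_def)
  then show ?thesis by simp
qed

lemma limsup_le_ObsDiam:
  assumes pyr: "\<And>n. L_pyramid Lip1 (\<P>s n)" and conv: "weakly_converges Lip1 \<P>s \<P>"
    and "0 < \<epsilon>" "\<kappa> + \<epsilon> < 1"
  shows "limsup (\<lambda>n. ObsDiam (\<P>s n) (\<kappa> + \<epsilon>)) \<le> ObsDiam \<P> \<kappa>"
proof (rule ccontr)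
  assume "\<not> ?thesis"
  then obtain c where c: "ObsDiam \<P> \<kappa> < c" "c < limsup (\<lambda>n. ObsDiam (\<P>s n) (\<kappa> + \<epsilon>))"
    using dense by (auto simp: not_le)
  define D where "D = enn2real c"
  have "c < top" using order_less_le_trans[OF c(2) top_greatest] .
  then have D: "c = ennreal D" "0 \<le> D" unfolding D_def by simp_all
  let ?\<alpha> = "1 - (\<kappa> + \<epsilon>)"
  define W where "W = 2 * D * real (nat \<lfloor>2 / ?\<alpha>\<rfloor>)"
  have "\<exists>\<^sub>F n in sequentially. ennreal D < ObsDiam (\<P>s n) (\<kappa> + \<epsilon>)"
  proof (rule ccontr)
    assume "\<not> ?thesis"
    then have "eventually (\<lambda>n. ObsDiam (\<P>s n) (\<kappa> + \<epsilon>) \<le> ennreal D) sequentially"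
      by (simp add: not_frequently not_less)
    then show False using Limsup_bounded c(2) D(1) by (metis not_less)
  qed
  then have "infinite {n. ennreal D < ObsDiam (\<P>s n) (\<kappa> + \<epsilon>)}"
    unfolding cofinite_eq_sequentially[symmetric] frequently_cofinite .
  then obtain r :: "nat \<Rightarrow> nat" where r: "strict_mono r"
      "\<And>k. ennreal D < ObsDiam (\<P>s (r k)) (\<kappa> + \<epsilon>)"
    using infinite_enumerate[of "{n. ennreal D < ObsDiam (\<P>s n) (\<kappa> + \<epsilon>)}"] by auto
  have "\<exists>\<sigma>. real_distribution \<sigma> \<and> line_data_set \<sigma> \<in> \<P>s (r k) \<and> ennreal D \<le> part_diam \<sigma> ?\<alpha> \<and>
           measure \<sigma> {0..W} = 1" for k
    unfolding W_def by (rule ex_compressed_distribution[OF pyr assms(4) D(2) r(2)])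
  then have "\<exists>\<sigma>. \<forall>k. real_distribution (\<sigma> k) \<and> line_data_set (\<sigma> k) \<in> \<P>s (r k) \<and>
      ennreal D \<le> part_diam (\<sigma> k) ?\<alpha> \<and> measure (\<sigma> k) {0..W} = 1"
    by (intro choice allI)
  then obtain \<sigma> where \<sigma>: "\<And>k. real_distribution (\<sigma> k)" "\<And>k. line_data_set (\<sigma> k) \<in> \<P>s (r k)"
      "\<And>k. ennreal D \<le> part_diam (\<sigma> k) ?\<alpha>" "\<And>k. measure (\<sigma> k) {0..W} = 1"
    by blast
  have "tight \<sigma>"
    unfolding tight_def
  proof (intro conjI allI impI \<sigma>(1))
    fix e :: real assume "0 < e"
    \<comment> \<open>\<open>tight\<close> speaks of half-open intervals: the left end -1 keeps a
      possible atom at 0, and the interval is nondegenerate even if \<open>W\<close> is 0.\<close>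
    have "1 - e < measure (\<sigma> k) {-1<..W}" for k
    proof -
      interpret real_distribution "\<sigma> k" by (rule \<sigma>(1))
      have "measure (\<sigma> k) {0..W} \<le> measure (\<sigma> k) {-1<..W}" by (intro finite_measure_mono) auto
      then show ?thesis using \<sigma>(4)[of k] \<open>0 < e\<close> by simp
    qed
    moreover have "-1 < W" using mult_nonneg_nonneg[OF D(2) of_nat_0_le_iff, of "nat \<lfloor>2 / ?\<alpha>\<rfloor>"]
      unfolding W_def by simp
    ultimately show "\<exists>a b. a < b \<and> (\<forall>n. 1 - e < measure (\<sigma> n) {a<..b})" by blast
  qed
  then obtain s \<tau> where s: "strict_mono (s :: nat \<Rightarrow> nat)" and \<tau>: "real_distribution \<tau>"
      and weak: "weak_conv_m (\<lambda>k. \<sigma> (s k)) \<tau>"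
    using tight_imp_convergent_subsubsequence[OF \<open>tight \<sigma>\<close> strict_mono_id] unfolding comp_def id_apply
    by (elim exE conjE) (rule that)
  \<comment> \<open>Weak convergence becomes pointwise convergence on one probability space; joint
    laws of \<open>Z\<close> and \<open>Y k\<close> then provide the couplings, and the same
    variables allow partial diameters to be compared.\<close>
  from Skorohod[OF \<sigma>(1) \<tau> weak] obtain \<Omega> :: "real measure" and Y Z where
    *: "prob_space \<Omega> \<and> (\<forall>k. Y k \<in> \<Omega> \<rightarrow>\<^sub>M borel) \<and> (\<forall>k. distr \<Omega> borel (Y k) = \<sigma> (s k)) \<and>
      Z \<in> \<Omega> \<rightarrow>\<^sub>M lborel \<and> distr \<Omega> borel Z = \<tau> \<and> (\<forall>\<omega>\<in>space \<Omega>. (\<lambda>k. Y k \<omega>) \<longlonglongrightarrow> Z \<omega>)"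
    by (elim exE)
  then have \<Omega>: "prob_space \<Omega>"
      and Y: "\<And>k. Y k \<in> borel_measurable \<Omega>" "\<And>k. distr \<Omega> borel (Y k) = \<sigma> (s k)"
      and Z: "Z \<in> borel_measurable \<Omega>" "distr \<Omega> borel Z = \<tau>"
      and YZ: "\<And>\<omega>. \<omega> \<in> space \<Omega> \<Longrightarrow> (\<lambda>k. Y k \<omega>) \<longlonglongrightarrow> Z \<omega>"
    by simp_all
  have close: "eventually (\<lambda>k. measure \<Omega> {\<omega> \<in> space \<Omega>. \<delta> < \<bar>Z \<omega> - Y k \<omega>\<bar>} \<le> \<delta>) sequentially"
    if "0 < \<delta>" for \<delta>
  proof -
    have "(\<lambda>k. measure \<Omega> {\<omega> \<in> space \<Omega>. \<delta> < \<bar>Z \<omega> - Y k \<omega>\<bar>}) \<longlonglongrightarrow> 0"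
      by (rule prob_space.tendsto_prob_deviation[OF \<Omega> Y(1) Z(1) _ that]) (rule YZ)
    from order_tendstoD(2)[OF this that] show ?thesis
      by (rule eventually_mono) (rule less_imp_le)
  qed
  have "line_data_set \<tau> \<in> \<P>"
  proof (rule ccontr)
    assume "line_data_set \<tau> \<notin> \<P>"
    then have "0 < liminf (\<lambda>n. box_dist_set (line_data_set \<tau>) (\<P>s n))"
      using conv real_distribution.line_in_L_data_sets[OF \<tau>] unfolding weakly_converges_def by blast
    then obtain x where x: "0 < x" "x < liminf (\<lambda>n. box_dist_set (line_data_set \<tau>) (\<P>s n))"
      using dense by blast
    define d where "d = enn2real x"
    have "x < top" using order_less_le_trans[OF x(2) top_greatest] .
    then have d: "x = ennreal d" "0 < d" using x(1) unfolding d_def by (simp_all add: enn2real_positive_iff)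
    \<comment> \<open>Chosen so that the bound \<open>4 * \<delta>\<close> of
      \<open>box_dist_line_le\<close> does not exceed \<open>d\<close>; the cap 1 / 2 keeps \<delta>
      below 1.\<close>
    define \<delta> where "\<delta> = min (d / 4) (1 / 2)"
    have \<delta>: "0 < \<delta>" "\<delta> < 1" "4 * \<delta> \<le> d" using d(2) unfolding \<delta>_def by auto
    have "eventually (\<lambda>n. x < box_dist_set (line_data_set \<tau>) (\<P>s n)) sequentially"
      by (rule less_LiminfD[OF x(2)])
    then have "eventually (\<lambda>k. x < box_dist_set (line_data_set \<tau>) (\<P>s (r (s k)))) sequentially"
      using eventually_subseq[OF strict_mono_o[OF r(1) s]] by (simp add: o_def)
    with close[OF \<delta>(1)] have "eventually (\<lambda>k. False) sequentially"
    proof eventually_elim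
      case (elim k)
      have "box_dist_set (line_data_set \<tau>) (\<P>s (r (s k))) \<le> box_dist (line_data_set \<tau>) (line_data_set (\<sigma> (s k)))"
        unfolding box_dist_set_def by (rule INF_lower) (rule \<sigma>(2))
      also have "\<dots> \<le> ennreal (4 * \<delta>)"
        by (rule box_dist_line_le[OF \<Omega> Z(1) Y(1) Z(2) Y(2) \<delta>(1,2) elim(1)])
      also have "\<dots> \<le> x" unfolding d(1) using \<delta>(3) by (rule ennreal_leI)
      finally show ?case using elim(2) by (simp add: not_less)
    qed
    then show False by simp
  qed
  have "ennreal D \<le> part_diam \<tau> (1 - \<kappa>)"
  proof (rule ennreal_le_epsilon)
    fix e :: real assume "0 < e"
    \<comment> \<open>With \<open>\<delta> \<le> \<epsilon>\<close> the level
      \<open>?\<alpha> + \<delta>\<close> stays at most 1 - \<kappa>; here the gap \<epsilon> is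
      spent.\<close>
    define \<delta> where "\<delta> = min (e / 2) \<epsilon>"
    have \<delta>: "0 < \<delta>" "\<delta> \<le> \<epsilon>" "2 * \<delta> \<le> e" using \<open>0 < e\<close> assms(3) unfolding \<delta>_def by auto
    obtain k where k: "measure \<Omega> {\<omega> \<in> space \<Omega>. \<delta> < \<bar>Z \<omega> - Y k \<omega>\<bar>} \<le> \<delta>"
      using eventually_happens'[OF sequentially_bot close[OF \<delta>(1)]] by blast
    have "ennreal D \<le> part_diam (\<sigma> (s k)) ?\<alpha>" by (rule \<sigma>(3))
    also have "\<dots> \<le> part_diam \<tau> (?\<alpha> + \<delta>) + ennreal (2 * \<delta>)"
      using part_diam_perturb[OF \<Omega> Z(1) Y(1) less_imp_le[OF \<delta>(1)] _ k, of ?\<alpha>] assms(4)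
      unfolding Y(2) Z(2) by simp
    also have "\<dots> \<le> part_diam \<tau> (1 - \<kappa>) + ennreal e"
      using \<delta> by (intro add_mono part_diam_mono ennreal_leI) auto
    finally show "ennreal D \<le> part_diam \<tau> (1 - \<kappa>) + ennreal e" .
  qed
  also have "\<dots> \<le> ObsDiam \<P> \<kappa>"
    by (rule part_diam_le_ObsDiam_line[OF \<tau> \<open>line_data_set \<tau> \<in> \<P>\<close>])
  finally show False using c(1) D(1) by simp
qed

text \<open>Since liminf is at most limsup, the lower bound for the former and the upper bound for
  the latter enclose both families.\<close>

theorem corollary1p3:
  fixes \<P>s :: "nat \<Rightarrow> real data_set set" and \<P> :: "real data_set set" and \<kappa> :: real
  assumes "\<And>n. L_pyramid Lip1 (\<P>s n)"
    and "weakly_converges Lip1 \<P>s \<P>"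
    and "0 < \<kappa>" and "\<kappa> < 1"
  shows "((\<lambda>\<epsilon>. liminf (\<lambda>n. ObsDiam (\<P>s n) (\<kappa> + \<epsilon>))) \<longlongrightarrow> ObsDiam \<P> \<kappa>) (at_right 0) \<and>
         ((\<lambda>\<epsilon>. limsup (\<lambda>n. ObsDiam (\<P>s n) (\<kappa> + \<epsilon>))) \<longlongrightarrow> ObsDiam \<P> \<kappa>) (at_right 0)"
proof -
  let ?inf = "\<lambda>\<epsilon>. liminf (\<lambda>n. ObsDiam (\<P>s n) (\<kappa> + \<epsilon>))"
  let ?sup = "\<lambda>\<epsilon>. limsup (\<lambda>n. ObsDiam (\<P>s n) (\<kappa> + \<epsilon>))"
  have le: "?inf \<epsilon> \<le> ?sup \<epsilon>" for \<epsilon> by (simp add: Liminf_le_Limsup)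
  have upper: "eventually (\<lambda>\<epsilon>. ?sup \<epsilon> \<le> ObsDiam \<P> \<kappa>) (at_right 0)"
    unfolding eventually_at_right_field
    using limsup_le_ObsDiam[OF assms(1,2)] assms(4) by (intro exI[of _ "1 - \<kappa>"]) auto
  have lower: "eventually (\<lambda>\<epsilon>. c < ?inf \<epsilon>) (at_right 0)" if c: "c < ObsDiam \<P> \<kappa>" for c
  proof -
    \<comment> \<open>\<open>ObsDiam_le_liminf\<close> concludes with \<le>; the intermediate value
      restores the strict inequality that the limit criterion asks for.\<close>
    obtain c' where c': "c < c'" "c' < ObsDiam \<P> \<kappa>" using dense[OF c] by blast
    obtain \<eta> where "0 < \<eta>" "\<And>\<epsilon>. 0 < \<epsilon> \<Longrightarrow> \<epsilon> < \<eta> \<Longrightarrow> c' \<le> ?inf \<epsilon>"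
      using ObsDiam_le_liminf[OF assms(1,2,4) c'(2)] by blast
    then show ?thesis
      unfolding eventually_at_right_field using c'(1) less_le_trans by (intro exI[of _ \<eta>]) blast
  qed
  show ?thesis
  proof (intro conjI order_tendstoI)
    fix c assume "c < ObsDiam \<P> \<kappa>"
    from lower[OF this] show "eventually (\<lambda>\<epsilon>. c < ?inf \<epsilon>) (at_right 0)" .
    then show "eventually (\<lambda>\<epsilon>. c < ?sup \<epsilon>) (at_right 0)"
      by (rule eventually_mono) (rule less_le_trans[OF _ le])
  next
    fix c assume c: "ObsDiam \<P> \<kappa> < c"
    show "eventually (\<lambda>\<epsilon>. ?sup \<epsilon> < c) (at_right 0)"
      using upper by (rule eventually_mono) (rule le_less_trans[OF _ c])
    then show "eventually (\<lambda>\<epsilon>. ?inf \<epsilon> < c) (at_right 0)"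
      by (rule eventually_mono) (rule le_less_trans[OF le])
  qed
qed

end
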